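(* Let $H,T$ be finitary endofunctors on $\mathrm{Set}$ and let $\mathbf{M}=(M,m,u)$ be a monad on $\mathrm{Set}$ with $M$ finitary. Assume that $H$ has an algebra lift $\widetilde{H}$ to $\mathrm{Alg}(\mathbf{M})$, that $T$ has a Kleisli lift with respect to $\mathbf{M}$, and that $MT\cong HM$ as $\mathbf{M}$-algebras. If $H$ is $\omega^{op}$-continuous and $M0=1$ as $\mathbf{M}$-algebras, then the final $H$-coalgebra is the completion of the free $\mathbf{M}$-algebra built on the initial $T$-algebra under a suitable metric. That is, let $A_T$ be the carrier of the initial $T$-algebra and let $(L,d)$ be the final $H$-coalgebra with the ultrametric coming from the final sequence (see context). Then there are a metric on the underlying set $MA_T$ of the free algebra $F^{\mathbf{M}}A_T$ and an $\mathbf{M}$-algebra morphism $F^{\mathbf{M}}A_T\to L$ which is an isometric embedding with dense image into the complete metric space $(L,d)$; in other words, it exhibits $(L,d)$ as the Cauchy completion of $MA_T$.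
   Context: $\mathrm{Alg}(\mathbf{M})$ is the Eilenberg-Moore category of $\mathbf{M}$, with forgetful functor $U^{\mathbf{M}}$ and free functor $F^{\mathbf{M}}$; $\mathrm{Kl}(\mathbf{M})$ is the Kleisli category, with canonical functor $F_{\mathbf{M}}:\mathrm{Set}\to\mathrm{Kl}(\mathbf{M})$. An algebra lift of $H$ is an endofunctor $\widetilde{H}$ of $\mathrm{Alg}(\mathbf{M})$ with $U^{\mathbf{M}}\widetilde{H}=HU^{\mathbf{M}}$. Equivalently, it is given by a natural transformation $\lambda:MH\to HM$ with $\lambda\circ u_H=Hu$ and $\lambda\circ m_H=Hm\circ\lambda_M\circ M\lambda$, via $\widetilde{H}(X,x)=(HX,Hx\circ\lambda_X)$. A Kleisli lift of $T$ is an endofunctor $\hat{T}$ of $\mathrm{Kl}(\mathbf{M})$ with $\hat{T}F_{\mathbf{M}}=F_{\mathbf{M}}T$. "$MT\cong HM$ as $\mathbf{M}$-algebras" means that there is a natural isomorphism $\phi:HM\to MT$ such that for each set $X$ the component $\phi_X$ is an $\mathbf{M}$-algebra morphism $\widetilde{H}F^{\mathbf{M}}X\to F^{\mathbf{M}}TX$, i.e. $\phi_X\circ Hm_X\circ\lambda_{MX}=m_{TX}\circ M\phi_X$. "$M0=1$ as $\mathbf{M}$-algebras" means that the unique algebra morphism from the initial algebra $F^{\mathbf{M}}0=(M0,m_0)$ to the terminal algebra $1$ is an isomorphism. Finitary means preserving filtered colimits; $\omega^{op}$-continuous means preserving limits of $\omega^{op}$-chains. Final sequence: let $t:H1\to1$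 be the unique map and let $L$ be the limit in $\mathrm{Set}$ of $1\xleftarrow{t}H1\xleftarrow{Ht}H^21\leftarrow\cdots$, with projections $p_n:L\to H^n1$. Since $H$ is $\omega^{op}$-continuous, $L$ with the unique isomorphism $\xi:L\to HL$ satisfying $Hp_{n-1}\circ\xi=p_n$ ($n\ge1$) is the final $H$-coalgebra. The ultrametric is $d(x,x)=0$ and $d(x,y)=2^{-n}$ for $x\ne y$, with $n$ the smallest natural number such that $p_n(x)\neq p_n(y)$. The $\mathbf{M}$-algebra structure on $L$ is the unique map $\gamma:ML\to L$ with $\xi\circ\gamma=H\gamma\circ\lambda_L\circ M\xi$. *)

theory Defs
  imports "HOL-Analysis.Analysis"
begin

section \<open>Categories and functors\<close>

text \<open>
  Arrows do not carry their domain and codomain: these are passed as arguments to the composition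
  and to the arrow part of a functor.  \<open>Comp C X Y Z g f\<close> is the composite of \<open>f : X \<rightarrow> Y\<close> and
  \<open>g : Y \<rightarrow> Z\<close>, and \<open>FMap F X Y f\<close> is the value of \<open>F\<close> at \<open>f : X \<rightarrow> Y\<close>.
\<close>

record ('o, 'a) category =
  Obj :: "'o set"
  Hom :: "'o \<Rightarrow> 'o \<Rightarrow> 'a set"
  Ide :: "'o \<Rightarrow> 'a"
  Comp :: "'o \<Rightarrow> 'o \<Rightarrow> 'o \<Rightarrow> 'a \<Rightarrow> 'a \<Rightarrow> 'a"

definition is_category :: "('o, 'a) category \<Rightarrow> bool" where
  "is_category C \<longleftrightarrow>
     (\<forall>X\<in>Obj C. Ide C X \<in> Hom C X X) \<and>
     (\<forall>X\<in>Obj C. \<forall>Y\<in>Obj C. \<forall>Z\<in>Obj C. \<forall>f\<in>Hom C X Y. \<forall>g\<in>Hom C Y Z.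
        Comp C X Y Z g f \<in> Hom C X Z) \<and>
     (\<forall>X\<in>Obj C. \<forall>Y\<in>Obj C. \<forall>f\<in>Hom C X Y.
        Comp C X X Y f (Ide C X) = f \<and> Comp C X Y Y (Ide C Y) f = f) \<and>
     (\<forall>W\<in>Obj C. \<forall>X\<in>Obj C. \<forall>Y\<in>Obj C. \<forall>Z\<in>Obj C.
        \<forall>f\<in>Hom C W X. \<forall>g\<in>Hom C X Y. \<forall>h\<in>Hom C Y Z.
        Comp C W X Z (Comp C X Y Z h g) f = Comp C W Y Z h (Comp C W X Y g f))"

definition is_iso :: "('o, 'a) category \<Rightarrow> 'o \<Rightarrow> 'o \<Rightarrow> 'a \<Rightarrow> bool" where
  "is_iso C X Y f \<longleftrightarrow> f \<in> Hom C X Y \<and>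
     (\<exists>g\<in>Hom C Y X. Comp C X Y X g f = Ide C X \<and> Comp C Y X Y f g = Ide C Y)"

record ('o, 'a, 'p, 'b) funct =
  FObj :: "'o \<Rightarrow> 'p"
  FMap :: "'o \<Rightarrow> 'o \<Rightarrow> 'a \<Rightarrow> 'b"

type_synonym ('o, 'a) endofunct = "('o, 'a, 'o, 'a) funct"

definition is_functor ::
  "('o, 'a) category \<Rightarrow> ('p, 'b) category \<Rightarrow> ('o, 'a, 'p, 'b) funct \<Rightarrow> bool" where
  "is_functor C D F \<longleftrightarrow>
     (\<forall>X\<in>Obj C. FObj F X \<in> Obj D) \<and>
     (\<forall>X\<in>Obj C. \<forall>Y\<in>Obj C. \<forall>f\<in>Hom C X Y. FMap F X Y f \<in> Hom D (FObj F X) (FObj F Y)) \<and>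
     (\<forall>X\<in>Obj C. FMap F X X (Ide C X) = Ide D (FObj F X)) \<and>
     (\<forall>X\<in>Obj C. \<forall>Y\<in>Obj C. \<forall>Z\<in>Obj C. \<forall>f\<in>Hom C X Y. \<forall>g\<in>Hom C Y Z.
        FMap F X Z (Comp C X Y Z g f) =
        Comp D (FObj F X) (FObj F Y) (FObj F Z) (FMap F Y Z g) (FMap F X Y f))"

definition id_funct :: "('o, 'a) endofunct" where
  "id_funct = \<lparr>FObj = (\<lambda>X. X), FMap = (\<lambda>X Y f. f)\<rparr>"

definition comp_funct ::
  "('p, 'b, 'q, 'c) funct \<Rightarrow> ('o, 'a, 'p, 'b) funct \<Rightarrow> ('o, 'a, 'q, 'c) funct" (infixl "\<circ>\<^sub>F" 55)
  where
  "G \<circ>\<^sub>F F = \<lparr>FObj = (\<lambda>X. FObj G (FObj F X)),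
             FMap = (\<lambda>X Y f. FMap G (FObj F X) (FObj F Y) (FMap F X Y f))\<rparr>"

text \<open>Equality of functors on \<open>C\<close>; values outside the objects and arrows of \<open>C\<close> are irrelevant.\<close>

definition functor_eq ::
  "('o, 'a) category \<Rightarrow> ('o, 'a, 'p, 'b) funct \<Rightarrow> ('o, 'a, 'p, 'b) funct \<Rightarrow> bool" where
  "functor_eq C F G \<longleftrightarrow>
     (\<forall>X\<in>Obj C. FObj F X = FObj G X) \<and>
     (\<forall>X\<in>Obj C. \<forall>Y\<in>Obj C. \<forall>f\<in>Hom C X Y. FMap F X Y f = FMap G X Y f)"

definition is_nat_trans ::
  "('o, 'a) category \<Rightarrow> ('p, 'b) category \<Rightarrow> ('o, 'a, 'p, 'b) funct \<Rightarrow> ('o, 'a, 'p, 'b) funct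
     \<Rightarrow> ('o \<Rightarrow> 'b) \<Rightarrow> bool" where
  "is_nat_trans C D F G \<tau> \<longleftrightarrow>
     (\<forall>X\<in>Obj C. \<tau> X \<in> Hom D (FObj F X) (FObj G X)) \<and>
     (\<forall>X\<in>Obj C. \<forall>Y\<in>Obj C. \<forall>f\<in>Hom C X Y.
        Comp D (FObj F X) (FObj F Y) (FObj G Y) (\<tau> Y) (FMap F X Y f) =
        Comp D (FObj F X) (FObj G X) (FObj G Y) (FMap G X Y f) (\<tau> X))"

definition is_nat_iso ::
  "('o, 'a) category \<Rightarrow> ('p, 'b) category \<Rightarrow> ('o, 'a, 'p, 'b) funct \<Rightarrow> ('o, 'a, 'p, 'b) funct
     \<Rightarrow> ('o \<Rightarrow> 'b) \<Rightarrow> bool" where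
  "is_nat_iso C D F G \<tau> \<longleftrightarrow>
     is_nat_trans C D F G \<tau> \<and> (\<forall>X\<in>Obj C. is_iso D (FObj F X) (FObj G X) (\<tau> X))"


section \<open>Filtered colimits and limits of chains\<close>

definition is_cocone ::
  "('j, 'k) category \<Rightarrow> ('o, 'a) category \<Rightarrow> ('j, 'k, 'o, 'a) funct \<Rightarrow> 'o \<Rightarrow> ('j \<Rightarrow> 'a) \<Rightarrow> bool" where
  "is_cocone J C D X c \<longleftrightarrow> X \<in> Obj C \<and>
     (\<forall>i\<in>Obj J. c i \<in> Hom C (FObj D i) X) \<and>
     (\<forall>i\<in>Obj J. \<forall>j\<in>Obj J. \<forall>f\<in>Hom J i j. Comp C (FObj D i) (FObj D j) X (c j) (FMap D i j f) = c i)"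

definition is_colimit ::
  "('j, 'k) category \<Rightarrow> ('o, 'a) category \<Rightarrow> ('j, 'k, 'o, 'a) funct \<Rightarrow> 'o \<Rightarrow> ('j \<Rightarrow> 'a) \<Rightarrow> bool" where
  "is_colimit J C D X c \<longleftrightarrow> is_cocone J C D X c \<and>
     (\<forall>Y e. is_cocone J C D Y e \<longrightarrow>
        (\<exists>!h. h \<in> Hom C X Y \<and> (\<forall>i\<in>Obj J. Comp C (FObj D i) X Y h (c i) = e i)))"

definition is_filtered :: "('j, 'k) category \<Rightarrow> bool" where
  "is_filtered J \<longleftrightarrow> is_category J \<and> Obj J \<noteq> {} \<and>
     (\<forall>i\<in>Obj J. \<forall>j\<in>Obj J. \<exists>k\<in>Obj J. Hom J i k \<noteq> {} \<and> Hom J j k \<noteq> {}) \<and>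
     (\<forall>i\<in>Obj J. \<forall>j\<in>Obj J. \<forall>f\<in>Hom J i j. \<forall>g\<in>Hom J i j.
        \<exists>k\<in>Obj J. \<exists>h\<in>Hom J j k. Comp J i j k h f = Comp J i j k h g)"

text \<open>A chain \<open>X 0 \<leftarrow> X 1 \<leftarrow> X 2 \<leftarrow> \<dots>\<close> with connecting arrows \<open>x n : X (Suc n) \<rightarrow> X n\<close>.\<close>

definition is_op_chain :: "('o, 'a) category \<Rightarrow> (nat \<Rightarrow> 'o) \<Rightarrow> (nat \<Rightarrow> 'a) \<Rightarrow> bool" where
  "is_op_chain C X x \<longleftrightarrow> (\<forall>n. X n \<in> Obj C \<and> x n \<in> Hom C (X (Suc n)) (X n))"

definition is_chain_cone ::
  "('o, 'a) category \<Rightarrow> (nat \<Rightarrow> 'o) \<Rightarrow> (nat \<Rightarrow> 'a) \<Rightarrow> 'o \<Rightarrow> (nat \<Rightarrow> 'a) \<Rightarrow> bool" where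
  "is_chain_cone C X x L p \<longleftrightarrow> L \<in> Obj C \<and>
     (\<forall>n. p n \<in> Hom C L (X n) \<and> Comp C L (X (Suc n)) (X n) (x n) (p (Suc n)) = p n)"

definition is_chain_limit ::
  "('o, 'a) category \<Rightarrow> (nat \<Rightarrow> 'o) \<Rightarrow> (nat \<Rightarrow> 'a) \<Rightarrow> 'o \<Rightarrow> (nat \<Rightarrow> 'a) \<Rightarrow> bool" where
  "is_chain_limit C X x L p \<longleftrightarrow> is_chain_cone C X x L p \<and>
     (\<forall>K q. is_chain_cone C X x K q \<longrightarrow>
        (\<exists>!h. h \<in> Hom C K L \<and> (\<forall>n. Comp C K L (X n) (p n) h = q n)))"

definition omega_op_continuous :: "('o, 'a) category \<Rightarrow> ('o, 'a) endofunct \<Rightarrow> bool" where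
  "omega_op_continuous C H \<longleftrightarrow>
     (\<forall>X x L p. is_op_chain C X x \<and> is_chain_limit C X x L p \<longrightarrow>
        is_chain_limit C (\<lambda>n. FObj H (X n)) (\<lambda>n. FMap H (X (Suc n)) (X n) (x n))
          (FObj H L) (\<lambda>n. FMap H L (X n) (p n)))"


section \<open>Algebras and coalgebras for an endofunctor\<close>

definition is_initial_algebra ::
  "('o, 'a) category \<Rightarrow> ('o, 'a) endofunct \<Rightarrow> 'o \<Rightarrow> 'a \<Rightarrow> bool" where
  "is_initial_algebra C T A \<alpha> \<longleftrightarrow> A \<in> Obj C \<and> \<alpha> \<in> Hom C (FObj T A) A \<and>
     (\<forall>B\<in>Obj C. \<forall>\<beta>\<in>Hom C (FObj T B) B.
        \<exists>!h. h \<in> Hom C A B \<and>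
          Comp C (FObj T A) A B h \<alpha> = Comp C (FObj T A) (FObj T B) B \<beta> (FMap T A B h))"

definition is_final_coalgebra ::
  "('o, 'a) category \<Rightarrow> ('o, 'a) endofunct \<Rightarrow> 'o \<Rightarrow> 'a \<Rightarrow> bool" where
  "is_final_coalgebra C H L \<xi> \<longleftrightarrow> L \<in> Obj C \<and> \<xi> \<in> Hom C L (FObj H L) \<and>
     (\<forall>B\<in>Obj C. \<forall>\<beta>\<in>Hom C B (FObj H B).
        \<exists>!h. h \<in> Hom C B L \<and>
          Comp C B L (FObj H L) \<xi> h = Comp C B (FObj H B) (FObj H L) (FMap H B L h) \<beta>)"


section \<open>Monads, Eilenberg--Moore and Kleisli categories, liftings\<close>

record ('o, 'a) monad =
  Fun :: "('o, 'a) endofunct"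
  Mult :: "'o \<Rightarrow> 'a"
  Unit :: "'o \<Rightarrow> 'a"

abbreviation MObj :: "('o, 'a) monad \<Rightarrow> 'o \<Rightarrow> 'o" where
  "MObj M \<equiv> FObj (Fun M)"

abbreviation MMap :: "('o, 'a) monad \<Rightarrow> 'o \<Rightarrow> 'o \<Rightarrow> 'a \<Rightarrow> 'a" where
  "MMap M \<equiv> FMap (Fun M)"

definition is_monad :: "('o, 'a) category \<Rightarrow> ('o, 'a) monad \<Rightarrow> bool" where
  "is_monad C M \<longleftrightarrow>
     is_functor C C (Fun M) \<and>
     is_nat_trans C C (Fun M \<circ>\<^sub>F Fun M) (Fun M) (Mult M) \<and>
     is_nat_trans C C id_funct (Fun M) (Unit M) \<and>
     (\<forall>X\<in>Obj C.
        Comp C (MObj M X) (MObj M (MObj M X)) (MObj M X) (Mult M X) (Unit M (MObj M X))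
          = Ide C (MObj M X) \<and>
        Comp C (MObj M X) (MObj M (MObj M X)) (MObj M X) (Mult M X)
            (MMap M X (MObj M X) (Unit M X))
          = Ide C (MObj M X) \<and>
        Comp C (MObj M (MObj M (MObj M X))) (MObj M (MObj M X)) (MObj M X)
            (Mult M X) (Mult M (MObj M X))
          = Comp C (MObj M (MObj M (MObj M X))) (MObj M (MObj M X)) (MObj M X)
            (Mult M X) (MMap M (MObj M (MObj M X)) (MObj M X) (Mult M X)))"

definition Alg :: "('o, 'a) category \<Rightarrow> ('o, 'a) monad \<Rightarrow> ('o \<times> 'a, 'a) category" where
  "Alg C M =
    \<lparr>Obj = {(X, x). X \<in> Obj C \<and> x \<in> Hom C (MObj M X) X \<and>
        Comp C X (MObj M X) X x (Unit M X) = Ide C X \<and>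
        Comp C (MObj M (MObj M X)) (MObj M X) X x (Mult M X) =
        Comp C (MObj M (MObj M X)) (MObj M X) X x (MMap M (MObj M X) X x)},
     Hom = (\<lambda>(X, x) (Y, y). {f \<in> Hom C X Y.
        Comp C (MObj M X) X Y f x = Comp C (MObj M X) (MObj M Y) Y y (MMap M X Y f)}),
     Ide = (\<lambda>(X, x). Ide C X),
     Comp = (\<lambda>(X, x) (Y, y) (Z, z). Comp C X Y Z)\<rparr>"

definition forgetful :: "('o \<times> 'a, 'a, 'o, 'a) funct" where
  "forgetful = \<lparr>FObj = fst, FMap = (\<lambda>_ _ f. f)\<rparr>"

definition free_alg :: "('o, 'a) monad \<Rightarrow> ('o, 'a, 'o \<times> 'a, 'a) funct" where
  "free_alg M = \<lparr>FObj = (\<lambda>X. (MObj M X, Mult M X)), FMap = MMap M\<rparr>"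

definition Kl :: "('o, 'a) category \<Rightarrow> ('o, 'a) monad \<Rightarrow> ('o, 'a) category" where
  "Kl C M =
    \<lparr>Obj = Obj C,
     Hom = (\<lambda>X Y. Hom C X (MObj M Y)),
     Ide = Unit M,
     Comp = (\<lambda>X Y Z g f. Comp C X (MObj M (MObj M Z)) (MObj M Z) (Mult M Z)
        (Comp C X (MObj M Y) (MObj M (MObj M Z)) (MMap M Y (MObj M Z) g) f))\<rparr>"

definition kleisli_embed :: "('o, 'a) category \<Rightarrow> ('o, 'a) monad \<Rightarrow> ('o, 'a) endofunct" where
  "kleisli_embed C M =
    \<lparr>FObj = (\<lambda>X. X), FMap = (\<lambda>X Y f. Comp C X Y (MObj M Y) (Unit M Y) f)\<rparr>"

definition is_algebra_lift ::
  "('o, 'a) category \<Rightarrow> ('o, 'a) monad \<Rightarrow> ('o, 'a) endofunct \<Rightarrow> ('o \<times> 'a, 'a) endofunct \<Rightarrow> bool"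
  where
  "is_algebra_lift C M H H' \<longleftrightarrow>
     is_functor (Alg C M) (Alg C M) H' \<and>
     functor_eq (Alg C M) (forgetful \<circ>\<^sub>F H') (H \<circ>\<^sub>F forgetful)"

definition is_kleisli_lift ::
  "('o, 'a) category \<Rightarrow> ('o, 'a) monad \<Rightarrow> ('o, 'a) endofunct \<Rightarrow> ('o, 'a) endofunct \<Rightarrow> bool" where
  "is_kleisli_lift C M T T' \<longleftrightarrow>
     is_functor (Kl C M) (Kl C M) T' \<and>
     functor_eq C (T' \<circ>\<^sub>F kleisli_embed C M) (kleisli_embed C M \<circ>\<^sub>F T)"

text \<open>
  The natural transformation \<open>\<lambda> : M H \<rightarrow> H M\<close> corresponding to an algebra lift \<open>H'\<close> of \<open>H\<close>:
  \<open>\<lambda>\<^sub>X\<close> is the composite of \<open>M H u\<^sub>X : M H X \<rightarrow> M H M X\<close> with the algebra structure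
  \<open>M H M X \<rightarrow> H M X\<close> of the lift of the free algebra on \<open>X\<close>.
\<close>

definition lift_law ::
  "('o, 'a) category \<Rightarrow> ('o, 'a) monad \<Rightarrow> ('o, 'a) endofunct \<Rightarrow> ('o \<times> 'a, 'a) endofunct \<Rightarrow> 'o \<Rightarrow> 'a"
  where
  "lift_law C M H H' X =
     Comp C (MObj M (FObj H X)) (MObj M (FObj H (MObj M X))) (FObj H (MObj M X))
       (snd (FObj H' (FObj (free_alg M) X)))
       (MMap M (FObj H X) (FObj H (MObj M X)) (FMap H X (MObj M X) (Unit M X)))"

text \<open>\<open>M T \<cong> H M\<close> as algebras, where \<open>H M X\<close> carries the structure given by the lift \<open>H'\<close>.\<close>

definition is_alg_nat_iso ::
  "('o, 'a) category \<Rightarrow> ('o, 'a) monad \<Rightarrow> ('o, 'a) endofunct \<Rightarrow> ('o \<times> 'a, 'a) endofunct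
     \<Rightarrow> ('o, 'a) endofunct \<Rightarrow> ('o \<Rightarrow> 'a) \<Rightarrow> bool" where
  "is_alg_nat_iso C M H H' T \<phi> \<longleftrightarrow>
     is_nat_iso C C (H \<circ>\<^sub>F Fun M) (Fun M \<circ>\<^sub>F T) \<phi> \<and>
     (\<forall>X\<in>Obj C. \<phi> X \<in> Hom (Alg C M) (FObj H' (FObj (free_alg M) X)) (FObj (free_alg M) (FObj T X)))"


section \<open>The category of sets\<close>

text \<open>
  HOL has no type of all sets, so ``sets'' are the members of a universe \<open>U\<close> of subsets of an
  arbitrary type.  The closure conditions say that \<open>U\<close> consists of all subsets of cardinality
  less than \<open>\<kappa>\<close>, for some regular uncountable \<open>\<kappa>\<close> such that \<open>\<mu> < \<kappa>\<close> implies
  \<open>\<mu>\<^sup>\<omega> < \<kappa>\<close>.  In particular \<open>\<kappa>\<close> may be (strongly) inaccessible, so that every Grothendieck universe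
  with an infinite member is covered.  The last condition says that the set of sequences in a
  member of \<open>U\<close> has a copy in \<open>U\<close>.
\<close>

definition set_universe :: "'u set set \<Rightarrow> bool" where
  "set_universe U \<longleftrightarrow>
     (\<exists>A\<in>U. infinite A) \<and>
     (\<forall>A\<in>U. \<forall>f B. B \<subseteq> f ` A \<longrightarrow> B \<in> U) \<and>
     (\<forall>A\<in>U. \<forall>B. (\<forall>a\<in>A. B a \<in> U) \<longrightarrow> (\<Union>a\<in>A. B a) \<in> U) \<and>
     (\<forall>A\<in>U. \<exists>c :: (nat \<Rightarrow> 'u) \<Rightarrow> 'u.
        inj_on c {s. range s \<subseteq> A} \<and> c ` {s. range s \<subseteq> A} \<in> U)"

definition SET :: "'u set set \<Rightarrow> ('u set, 'u \<Rightarrow> 'u) category" where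
  "SET U =
    \<lparr>Obj = U,
     Hom = (\<lambda>A B. A \<rightarrow>\<^sub>E B),
     Ide = (\<lambda>A. \<lambda>a\<in>A. a),
     Comp = (\<lambda>A B C g f. compose A g f)\<rparr>"

text \<open>
  Small categories are taken with objects and arrows in \<open>'u\<close>; since \<open>U\<close> is closed under
  equipotence this is no restriction.
\<close>

definition is_small_category :: "'u set set \<Rightarrow> ('u, 'u) category \<Rightarrow> bool" where
  "is_small_category U J \<longleftrightarrow>
     is_category J \<and> Obj J \<in> U \<and> (\<forall>i\<in>Obj J. \<forall>j\<in>Obj J. Hom J i j \<in> U)"

definition finitary :: "'u set set \<Rightarrow> ('u set, 'u \<Rightarrow> 'u) endofunct \<Rightarrow> bool" where
  "finitary U F \<longleftrightarrow>
     (\<forall>J D X c. is_small_category U J \<and> is_filtered J \<and> is_functor J (SET U) D \<and>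
        is_colimit J (SET U) D X c \<longrightarrow>
        is_colimit J (SET U) (F \<circ>\<^sub>F D) (FObj F X) (\<lambda>i. FMap F (FObj D i) X (c i)))"

definition one :: "'u set" where
  "one = {undefined}"

definition to_one :: "'u set \<Rightarrow> 'u \<Rightarrow> 'u" where
  "to_one A = (\<lambda>a\<in>A. undefined)"

text \<open>
  \<open>M 0 = 1\<close> as algebras: the unique algebra morphism from the free algebra on the empty set to
  the terminal algebra, which is \<open>one\<close> with its only possible structure, is an isomorphism.
\<close>

definition free_empty_eq_one :: "'u set set \<Rightarrow> ('u set, 'u \<Rightarrow> 'u) monad \<Rightarrow> bool" where
  "free_empty_eq_one U M \<longleftrightarrow>
     is_iso (Alg (SET U) M) (FObj (free_alg M) {}) (one, to_one (MObj M one)) (to_one (MObj M {}))"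


section \<open>The final sequence\<close>

primrec fin_obj :: "('u set, 'u \<Rightarrow> 'u) endofunct \<Rightarrow> nat \<Rightarrow> 'u set" where
  "fin_obj H 0 = one"
| "fin_obj H (Suc n) = FObj H (fin_obj H n)"

primrec fin_map :: "('u set, 'u \<Rightarrow> 'u) endofunct \<Rightarrow> nat \<Rightarrow> 'u \<Rightarrow> 'u" where
  "fin_map H 0 = to_one (FObj H one)"
| "fin_map H (Suc n) = FMap H (fin_obj H (Suc n)) (fin_obj H n) (fin_map H n)"

definition final_seq_limit ::
  "'u set set \<Rightarrow> ('u set, 'u \<Rightarrow> 'u) endofunct \<Rightarrow> 'u set \<Rightarrow> (nat \<Rightarrow> 'u \<Rightarrow> 'u) \<Rightarrow> bool" where
  "final_seq_limit U H L p \<longleftrightarrow> is_chain_limit (SET U) (fin_obj H) (fin_map H) L p"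

definition final_coalg_str ::
  "('u set, 'u \<Rightarrow> 'u) endofunct \<Rightarrow> 'u set \<Rightarrow> (nat \<Rightarrow> 'u \<Rightarrow> 'u) \<Rightarrow> 'u \<Rightarrow> 'u" where
  "final_coalg_str H L p =
     (THE \<xi>. \<xi> \<in> L \<rightarrow>\<^sub>E FObj H L \<and> (\<forall>n. compose L (FMap H L (fin_obj H n) (p n)) \<xi> = p (Suc n)))"

definition final_alg_str ::
  "'u set set \<Rightarrow> ('u set, 'u \<Rightarrow> 'u) monad \<Rightarrow> ('u set, 'u \<Rightarrow> 'u) endofunct
     \<Rightarrow> ('u set \<times> ('u \<Rightarrow> 'u), 'u \<Rightarrow> 'u) endofunct \<Rightarrow> 'u set \<Rightarrow> (nat \<Rightarrow> 'u \<Rightarrow> 'u) \<Rightarrow> 'u \<Rightarrow> 'u" where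
  "final_alg_str U M H H' L p =
     (let \<xi> = final_coalg_str H L p in
      THE \<gamma>. \<gamma> \<in> MObj M L \<rightarrow>\<^sub>E L \<and>
        compose (MObj M L) \<xi> \<gamma> =
        compose (MObj M L) (FMap H (MObj M L) L \<gamma>)
          (compose (MObj M L) (lift_law (SET U) M H H' L) (MMap M L (FObj H L) \<xi>)))"

definition final_dist :: "(nat \<Rightarrow> 'u \<Rightarrow> 'u) \<Rightarrow> 'u \<Rightarrow> 'u \<Rightarrow> real" where
  "final_dist p x y = (if x = y then 0 else (1 / 2) ^ (LEAST n. p n x \<noteq> p n y))"

definition is_completion_map ::
  "'b set \<Rightarrow> ('b \<Rightarrow> 'b \<Rightarrow> real) \<Rightarrow> 'c set \<Rightarrow> ('c \<Rightarrow> 'c \<Rightarrow> real) \<Rightarrow> ('b \<Rightarrow> 'c) \<Rightarrow> bool" where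
  "is_completion_map A d L e f \<longleftrightarrow>
     Metric_space A d \<and> Metric_space L e \<and> Metric_space.mcomplete L e \<and>
     f \<in> A \<rightarrow> L \<and> (\<forall>x\<in>A. \<forall>y\<in>A. e (f x) (f y) = d x y) \<and>
     Metric_space.mtopology L e closure_of (f ` A) = L"

end

theory Submission
  imports Defs
begin

text \<open>
  Since \<open>T\<close> is finitary, its initial algebra \<open>(A, \<alpha>)\<close> is the colimit of the chain
  \<open>T\<^sup>n 0\<close>, with injections \<open>c\<^sub>n\<close>; since \<open>M\<close> is finitary too, every element of \<open>M A\<close> comes along some \<open>M c\<^sub>n\<close>
  from a stage \<open>M T\<^sup>n 0\<close>.  The isomorphisms \<open>M T \<cong> H M\<close> and \<open>M 0 = 1\<close> combine to bijections
  \<open>\<psi>\<^sub>n : M T\<^sup>n 0 \<rightarrow> H\<^sup>n 1\<close>.  So the stages that exhaust \<open>M A\<close> are, up to bijection, the sets whose limit is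
  \<open>L\<close>, and it remains to relate \<open>M A\<close> and \<open>L\<close> by a map that respects these identifications.

  That map comes from finality.  By Lambek's lemma \<open>\<alpha>\<close> is invertible, so
  \<open>\<delta> = \<phi>\<^sub>A\<^sup>-\<^sup>1 \<circ> M \<alpha>\<^sup>-\<^sup>1 : M A \<rightarrow> M T A \<rightarrow> H M A\<close> is an \<open>H\<close>-coalgebra, and \<open>f : M A \<rightarrow> L\<close> is the
  coalgebra morphism into the final coalgebra.  Its projection \<open>q\<^sub>n = p\<^sub>n \<circ> f\<close> satisfies
  \<open>q\<^sub>0 = !\<close> and \<open>q\<^sub>n\<^sub>+\<^sub>1 = H q\<^sub>n \<circ> \<delta>\<close>, and two inductions along this recursion give everything.
  First, \<open>q\<^sub>n \<circ> M c\<^sub>n = \<psi>\<^sub>n\<close> (lemma \<open>q_c\<close>).  As \<open>\<psi>\<^sub>n\<close> is injective and two elements of \<open>M A\<close> have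
  a common stage, \<open>f\<close> is injective (\<open>q_separates\<close>), hence an isometry for the metric of \<open>L\<close> pulled back to
  \<open>M A\<close>; as \<open>\<psi>\<^sub>n\<close> is surjective, every \<open>p\<^sub>n(l)\<close> is also the \<open>n\<close>-th projection of a point of the image,
  which is density (\<open>q_onto\<close>).  Secondly, \<open>\<delta>\<close> is a morphism of algebras, so
  each \<open>q\<^sub>n\<close> is one (\<open>q_hom\<close>) when \<open>H\<^sup>n 1\<close> carries the \<open>n\<close>-fold lift of the terminal algebra.  The
  structure \<open>\<gamma>\<close> of \<open>L\<close> is the limit of these structures (\<open>final_alg_str_eq\<close>), so \<open>f\<close> is a
  morphism of algebras.  Finally, \<open>L\<close> is complete because the projections of a Cauchy sequence are
  eventually constant, their eventual values form a thread of the final sequence, and threads are points of the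
  limit.
\<close>

section \<open>Closure properties of a universe\<close>

lemma universe_infinite:
  assumes "set_universe U"
  obtains A where "A \<in> U" "infinite A"
  using assms[unfolded set_universe_def, THEN conjunct1] by (elim bexE)

lemma universe_subset_image:
  assumes "set_universe U" "A \<in> U" "B \<subseteq> f ` A"
  shows "B \<in> U"
  using assms(1)[unfolded set_universe_def, THEN conjunct2, THEN conjunct1] assms(2,3) by simp

lemma universe_subset:
  assumes "set_universe U" "A \<in> U" "B \<subseteq> A"
  shows "B \<in> U"
  using universe_subset_image[OF assms(1,2), of B id] assms(3) by simp

lemma universe_Union:
  assumes U: "set_universe U" and A: "A \<in> U" and B: "\<And>a. a \<in> A \<Longrightarrow> B a \<in> U"
  shows "(\<Union>a\<in>A. B a) \<in> U"
proof -
  have "\<forall>A\<in>U. \<forall>B. (\<forall>a\<in>A. B a \<in> U) \<longrightarrow> (\<Union>a\<in>A. B a) \<in> U"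
    using U[unfolded set_universe_def, THEN conjunct2, THEN conjunct2, THEN conjunct1] .
  from bspec[OF this A] show ?thesis
    by (rule allE[where x = B]) (use B in simp)
qed

lemma universe_empty:
  assumes U: "set_universe U"
  shows "{} \<in> U"
proof -
  obtain A where "A \<in> U" using universe_infinite[OF U] .
  then show ?thesis by (rule universe_subset[OF U]) simp
qed

lemma universe_singleton:
  assumes "set_universe U"
  shows "{a} \<in> U"
proof -
  obtain A where A: "A \<in> U" "infinite A"
    using universe_infinite[OF assms] .
  then obtain b where "b \<in> A" using infinite_imp_nonempty by blast
  then show ?thesis using universe_subset_image[OF assms A(1), of "{a}" "\<lambda>_. a"] by auto
qed

lemma universe_one: "set_universe U \<Longrightarrow> one \<in> U"
  by (simp add: one_def universe_singleton)

lemma universe_nat: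
  assumes "set_universe U"
  obtains \<nu> :: "nat \<Rightarrow> 'u" where "inj \<nu>" "range \<nu> \<in> (U :: 'u set set)"
proof -
  obtain A where A: "A \<in> U" "infinite A"
    using universe_infinite[OF assms] .
  then obtain \<nu> :: "nat \<Rightarrow> 'u" where "inj \<nu>" "range \<nu> \<subseteq> A"
    using infinite_countable_subset by blast
  then show ?thesis by (intro that universe_subset[OF assms A(1)])
qed

lemma universe_countable_Union:
  fixes X :: "nat \<Rightarrow> 'u set"
  assumes U: "set_universe U" and X: "\<And>n. X n \<in> U"
  shows "(\<Union>n. X n) \<in> U"
proof -
  obtain \<nu> :: "nat \<Rightarrow> 'u" where \<nu>: "inj \<nu>" "range \<nu> \<in> U"
    using universe_nat[OF U] .
  have "(\<Union>a\<in>range \<nu>. X (inv \<nu> a)) \<in> U"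
    by (rule universe_Union[OF U \<nu>(2)]) (rule X)
  then show ?thesis using \<nu>(1) by simp
qed

text \<open>Limits and colimits are first formed out of sequences or sets of sequences, whose types differ
  from that of the members of the universe, and are then carried back along an injection.\<close>

definition has_copy :: "'u set set \<Rightarrow> 'w set \<Rightarrow> bool" where
  "has_copy U W \<longleftrightarrow> (\<exists>e. inj_on e W \<and> e ` W \<in> U)"

lemma has_copy_inj:
  assumes U: "set_universe U" and V: "has_copy U V" and i: "inj_on i W" "i ` W \<subseteq> V"
  shows "has_copy U W"
proof -
  obtain e where e: "inj_on e V" "e ` V \<in> U" using V unfolding has_copy_def by blast
  have "inj_on (e \<circ> i) W" using e(1) i by (meson comp_inj_on inj_on_subset)
  moreover have "(e \<circ> i) ` W \<in> U"
    by (rule universe_subset[OF U e(2)]) (use i(2) in auto)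
  ultimately show ?thesis unfolding has_copy_def by blast
qed

text \<open>A quotient is copied by choosing a representative of every class.\<close>

lemma has_copy_image:
  assumes U: "set_universe U" and V: "has_copy U V"
  shows "has_copy U (g ` V)"
proof (rule has_copy_inj[OF U V])
  show "inj_on (inv_into V g) (g ` V)" by (rule inj_on_inv_into) simp
  show "inv_into V g ` g ` V \<subseteq> V" by (auto intro: inv_into_into)
qed

lemma has_copy_sequences:
  assumes "set_universe U" "A \<in> U"
  shows "has_copy U {s :: nat \<Rightarrow> 'u. range s \<subseteq> (A :: 'u set)}"
  using assms(1)[unfolded set_universe_def, THEN conjunct2, THEN conjunct2, THEN conjunct2] assms(2)
  unfolding has_copy_def by simp

lemma has_copy_threads:
  fixes X :: "nat \<Rightarrow> 'u set"
  assumes U: "set_universe U" and X: "\<And>n. X n \<in> U"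
  shows "has_copy U {s. (\<forall>n. s n \<in> X n) \<and> (\<forall>n. x n (s (Suc n)) = s n)}"
  by (rule has_copy_inj[OF U has_copy_sequences[OF U universe_countable_Union[OF U X]], where i = id])
    auto

text \<open>The pair \<open>(n, a)\<close> is coded by the sequence that starts with a name of \<open>n\<close> and is then
  constantly \<open>a\<close>.\<close>

lemma has_copy_Sigma:
  fixes X :: "nat \<Rightarrow> 'u set"
  assumes U: "set_universe U" and X: "\<And>n. X n \<in> U"
  shows "has_copy U (SIGMA n:UNIV. X n)"
proof -
  obtain \<nu> :: "nat \<Rightarrow> 'u" where \<nu>: "inj \<nu>" "range \<nu> \<in> U"
    using universe_nat[OF U] .
  define Y where "Y = rec_nat (range \<nu>) (\<lambda>n _. X n)"
  have "(\<Union>n. Y n) \<in> U"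
  proof (rule universe_countable_Union[OF U])
    show "Y n \<in> U" for n using \<nu>(2) X by (cases n) (auto simp: Y_def)
  qed
  then have copy: "has_copy U {s :: nat \<Rightarrow> 'u. range s \<subseteq> (\<Union>n. Y n)}"
    by (rule has_copy_sequences[OF U])
  have Y: "\<nu> n \<in> (\<Union>n. Y n)" "a \<in> X n \<Longrightarrow> a \<in> (\<Union>n. Y n)" for n a
  proof -
    have "\<nu> n \<in> Y 0" by (simp add: Y_def)
    then show "\<nu> n \<in> (\<Union>n. Y n)" by blast
    assume "a \<in> X n"
    then have "a \<in> Y (Suc n)" by (simp add: Y_def)
    then show "a \<in> (\<Union>n. Y n)" by blast
  qed
  define code where "code = (\<lambda>(n, a) k. if k = (0::nat) then \<nu> n else a)"
  show ?thesis
  proof (rule has_copy_inj[OF U copy])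
    show "inj_on code (SIGMA n:UNIV. X n)"
    proof (rule inj_onI)
      fix v w assume "code v = code w"
      then have "code v 0 = code w 0" "code v 1 = code w 1" by auto
      then show "v = w" using \<nu>(1) by (cases v; cases w) (auto simp: code_def inj_eq)
    qed
    show "code ` (SIGMA n:UNIV. X n) \<subseteq> {s. range s \<subseteq> (\<Union>n. Y n)}"
      using Y by (auto simp: code_def)
  qed
qed

section \<open>Sets and functors, pointwise\<close>

lemma SET_simps [simp]:
  "Obj (SET U) = U" "Hom (SET U) A B = A \<rightarrow>\<^sub>E B" "Ide (SET U) A = (\<lambda>a\<in>A. a)"
  "Comp (SET U) A B C g f = compose A g f"
  by (simp_all add: SET_def)

lemma compose_eq_iff:
  "h \<in> A \<rightarrow>\<^sub>E C \<Longrightarrow> compose A g f = h \<longleftrightarrow> (\<forall>a\<in>A. g (f a) = h a)"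
  by (auto simp: compose_def fun_eq_iff restrict_def PiE_def extensional_def)

lemma compose_eq_compose_iff:
  "compose A g f = compose A g' f' \<longleftrightarrow> (\<forall>a\<in>A. g (f a) = g' (f' a))"
  by (auto simp: compose_def fun_eq_iff restrict_def)

lemma compose_PiE: "f \<in> A \<rightarrow>\<^sub>E B \<Longrightarrow> g \<in> B \<rightarrow>\<^sub>E C \<Longrightarrow> compose A g f \<in> A \<rightarrow>\<^sub>E C"
  by (auto simp: compose_def)

lemma to_one_PiE: "to_one A \<in> A \<rightarrow>\<^sub>E one"
  by (auto simp: to_one_def one_def)

lemma one_unique: "a \<in> one \<Longrightarrow> b \<in> one \<Longrightarrow> a = b"
  by (simp add: one_def)

lemma PiE_eqI: "f \<in> A \<rightarrow>\<^sub>E B \<Longrightarrow> g \<in> A \<rightarrow>\<^sub>E C \<Longrightarrow> (\<And>a. a \<in> A \<Longrightarrow> f a = g a) \<Longrightarrow> f = g"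
  by (metis PiE_restrict restrict_ext)

text \<open>Arrows are extensional functions and composition restricts to the domain, so an equation
  between composites is used below as an equation between values on the domain.\<close>

locale set_functor =
  fixes U :: "'u set set" and F :: "('u set, 'u \<Rightarrow> 'u) endofunct"
  assumes universe: "set_universe U" and is_funct: "is_functor (SET U) (SET U) F"
begin

lemma obj: "X \<in> U \<Longrightarrow> FObj F X \<in> U"
  using is_funct unfolding is_functor_def by simp

lemma arr: "X \<in> U \<Longrightarrow> Y \<in> U \<Longrightarrow> f \<in> X \<rightarrow>\<^sub>E Y \<Longrightarrow> FMap F X Y f \<in> FObj F X \<rightarrow>\<^sub>E FObj F Y"
  using is_funct unfolding is_functor_def by simp

lemma app:
  "X \<in> U \<Longrightarrow> Y \<in> U \<Longrightarrow> f \<in> X \<rightarrow>\<^sub>E Y \<Longrightarrow> a \<in> FObj F X \<Longrightarrow> FMap F X Y f a \<in> FObj F Y"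
  using arr by blast

lemma triangle:
  assumes "X \<in> U" "Y \<in> U" "Z \<in> U" "f \<in> X \<rightarrow>\<^sub>E Y" "g \<in> Y \<rightarrow>\<^sub>E Z" "h \<in> X \<rightarrow>\<^sub>E Z"
    and "\<And>x. x \<in> X \<Longrightarrow> g (f x) = h x" and "a \<in> FObj F X"
  shows "FMap F Y Z g (FMap F X Y f a) = FMap F X Z h a"
proof -
  have "compose X g f = h" using assms by (simp add: compose_eq_iff)
  moreover have "FMap F X Z (compose X g f) = compose (FObj F X) (FMap F Y Z g) (FMap F X Y f)"
    using is_funct assms(1-5) unfolding is_functor_def by simp
  ultimately show ?thesis using assms(8) by (simp add: compose_eq)
qed

lemma square:
  assumes "X \<in> U" "Y \<in> U" "Y' \<in> U" "Z \<in> U"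
    and "f \<in> X \<rightarrow>\<^sub>E Y" "g \<in> Y \<rightarrow>\<^sub>E Z" "f' \<in> X \<rightarrow>\<^sub>E Y'" "g' \<in> Y' \<rightarrow>\<^sub>E Z"
    and "\<And>x. x \<in> X \<Longrightarrow> g (f x) = g' (f' x)" and "a \<in> FObj F X"
  shows "FMap F Y Z g (FMap F X Y f a) = FMap F Y' Z g' (FMap F X Y' f' a)"
proof -
  have "FMap F Y Z g (FMap F X Y f a) = FMap F X Z (compose X g f) a"
    by (rule triangle) (use assms in \<open>auto simp: compose_eq compose_PiE\<close>)
  also have "\<dots> = FMap F Y' Z g' (FMap F X Y' f' a)"
    by (rule triangle[symmetric]) (use assms in \<open>auto simp: compose_eq compose_PiE\<close>)
  finally show ?thesis .
qed

lemma retract: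
  assumes "X \<in> U" "Y \<in> U" "f \<in> X \<rightarrow>\<^sub>E Y" "g \<in> Y \<rightarrow>\<^sub>E X"
    and "\<And>x. x \<in> X \<Longrightarrow> g (f x) = x" and "a \<in> FObj F X"
  shows "FMap F Y X g (FMap F X Y f a) = a"
proof -
  have "FMap F Y X g (FMap F X Y f a) = FMap F X X (\<lambda>x\<in>X. x) a"
    by (rule triangle) (use assms in auto)
  also have "\<dots> = a" using is_funct assms(1,6) unfolding is_functor_def by simp
  finally show ?thesis .
qed

lemma bij:
  assumes "X \<in> U" "Y \<in> U" "f \<in> X \<rightarrow>\<^sub>E Y" "bij_betw f X Y"
  shows "bij_betw (FMap F X Y f) (FObj F X) (FObj F Y)"
proof -
  define g where "g = (\<lambda>y\<in>Y. inv_into X f y)"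
  have g: "g \<in> Y \<rightarrow>\<^sub>E X" "\<And>x. x \<in> X \<Longrightarrow> g (f x) = x" "\<And>y. y \<in> Y \<Longrightarrow> f (g y) = y"
    using assms(3,4) bij_betwE[OF bij_betw_inv_into[OF assms(4)]]
    by (auto simp: g_def bij_betw_inv_into_left bij_betw_inv_into_right PiE_mem)
  show ?thesis
  proof (rule bij_betw_byWitness[where f' = "FMap F Y X g"])
    show "\<forall>a\<in>FObj F X. FMap F Y X g (FMap F X Y f a) = a"
      using retract assms(1-3) g by blast
    show "\<forall>b\<in>FObj F Y. FMap F X Y f (FMap F Y X g b) = b"
      using retract assms(1-3) g by blast
    show "FMap F X Y f ` FObj F X \<subseteq> FObj F Y" "FMap F Y X g ` FObj F Y \<subseteq> FObj F X"
      using app assms(1-3) g(1) by blast+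
  qed
qed

end

section \<open>Limits of chains\<close>

lemma ex1_unique: "\<exists>!h. P h \<Longrightarrow> P f \<Longrightarrow> P g \<Longrightarrow> f = g"
  by blast

lemma chain_cone_iff:
  "is_chain_cone (SET U) X x L p \<longleftrightarrow>
     L \<in> U \<and> (\<forall>n. p n \<in> L \<rightarrow>\<^sub>E X n) \<and> (\<forall>n. \<forall>l\<in>L. x n (p (Suc n) l) = p n l)"
  unfolding is_chain_cone_def SET_simps using compose_eq_iff[where A = L] by metis

lemma chain_limit_arrow:
  assumes "is_chain_limit (SET U) X x L p" "K \<in> U" "\<And>n. q n \<in> K \<rightarrow>\<^sub>E X n"
    and "\<And>n k. k \<in> K \<Longrightarrow> x n (q (Suc n) k) = q n k"
  shows "\<exists>h\<in>K \<rightarrow>\<^sub>E L. \<forall>n. \<forall>k\<in>K. p n (h k) = q n k"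
proof -
  have "is_chain_cone (SET U) X x K q"
    using assms(2-4) by (simp add: chain_cone_iff)
  then have "\<exists>!h. h \<in> K \<rightarrow>\<^sub>E L \<and> (\<forall>n. compose K (p n) h = q n)"
    using assms(1) unfolding is_chain_limit_def by simp
  then obtain h where "h \<in> K \<rightarrow>\<^sub>E L" "\<forall>n. compose K (p n) h = q n"
    by (elim ex1E conjE) (rule that)
  then show ?thesis by (auto simp: compose_eq_iff[OF assms(3)])
qed

lemma chain_limit_cone:
  assumes "is_chain_limit (SET U) X x L p"
  shows "L \<in> U" and "p n \<in> L \<rightarrow>\<^sub>E X n" and "l \<in> L \<Longrightarrow> x n (p (Suc n) l) = p n l"
  using assms unfolding is_chain_limit_def chain_cone_iff by auto

text \<open>A thread is a cone over the chain with vertex \<open>1\<close>, and a point of \<open>L\<close> is a map from \<open>1\<close>.\<close>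

lemma chain_limit_thread:
  fixes U :: "'u set set"
  assumes U: "set_universe U" and L: "is_chain_limit (SET U) X x L p"
    and y: "\<And>n. y n \<in> X n" "\<And>n. x n (y (Suc n)) = y n"
  shows "\<exists>l\<in>L. \<forall>n. p n l = y n"
proof -
  have "\<exists>h\<in>(one :: 'u set) \<rightarrow>\<^sub>E L. \<forall>n. \<forall>k\<in>one. p n (h k) = (\<lambda>k\<in>one. y n) k"
    by (rule chain_limit_arrow[OF L universe_one[OF U], where q = "\<lambda>n. \<lambda>k\<in>one. y n"])
      (use y in auto)
  then show ?thesis by (auto simp: one_def)
qed

lemma chain_limit_eqI:
  fixes U :: "'u set set"
  assumes U: "set_universe U" and L: "is_chain_limit (SET U) X x L p"
    and l: "l \<in> L" "l' \<in> L" "\<And>n. p n l = p n l'"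
  shows "l = l'"
proof -
  note c = chain_limit_cone[OF L]
  have "is_chain_cone (SET U) X x one (\<lambda>n. \<lambda>k\<in>one. p n l)"
    using c l universe_one[OF U] by (auto simp: chain_cone_iff)
  then have ex1: "\<exists>!h. h \<in> (one :: 'u set) \<rightarrow>\<^sub>E L \<and> (\<forall>n. compose one (p n) h = (\<lambda>k\<in>one. p n l))"
    using L[unfolded is_chain_limit_def, THEN conjunct2, rule_format] by simp
  have "(\<lambda>k\<in>(one :: 'u set). l) = (\<lambda>k\<in>one. l')"
    by (rule ex1_unique[OF ex1]) (use l in \<open>auto simp: compose_def\<close>)
  from fun_cong[OF this, of undefined] show ?thesis by (simp add: one_def)
qed

lemma chain_limit_exists:
  fixes X :: "nat \<Rightarrow> 'u set"
  assumes U: "set_universe U" and X: "\<And>n. X n \<in> U"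
  shows "\<exists>L p. is_chain_limit (SET U) X x L p"
proof -
  define W where "W = {s. (\<forall>n. s n \<in> X n) \<and> (\<forall>n. x n (s (Suc n)) = s n)}"
  obtain e where e: "inj_on e W" "e ` W \<in> U"
    using has_copy_threads[of U X x, OF U X] unfolding has_copy_def W_def by blast
  define p where "p n = (\<lambda>l\<in>e ` W. inv_into W e l n)" for n
  have p: "p n (e s) = s n" if "s \<in> W" for n s
    using e(1) that by (simp add: p_def)
  have p_in: "p n \<in> e ` W \<rightarrow>\<^sub>E X n" for n
  proof (rule PiE_I)
    show "l \<in> e ` W \<Longrightarrow> p n l \<in> X n" for l using p by (auto simp: W_def)
  qed (simp add: p_def)
  have "is_chain_limit (SET U) X x (e ` W) p"
    unfolding is_chain_limit_def
  proof (intro conjI allI impI)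
    show "is_chain_cone (SET U) X x (e ` W) p"
      using e(2) p p_in by (auto simp: chain_cone_iff W_def)
    fix K q assume "is_chain_cone (SET U) X x K q"
    then have q: "q n \<in> K \<rightarrow>\<^sub>E X n" "k \<in> K \<Longrightarrow> x n (q (Suc n) k) = q n k" for n k
      by (auto simp: chain_cone_iff)
    have qW: "(\<lambda>n. q n k) \<in> W" if "k \<in> K" for k
      using q that by (auto simp: W_def)
    show "\<exists>!h. h \<in> Hom (SET U) K (e ` W) \<and> (\<forall>n. Comp (SET U) K (e ` W) (X n) (p n) h = q n)"
    proof (intro ex1I[where a = "\<lambda>k\<in>K. e (\<lambda>n. q n k)"])
      show "(\<lambda>k\<in>K. e (\<lambda>n. q n k)) \<in> Hom (SET U) K (e ` W) \<and>
        (\<forall>n. Comp (SET U) K (e ` W) (X n) (p n) (\<lambda>k\<in>K. e (\<lambda>n. q n k)) = q n)"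
        using q qW p by (auto simp: compose_eq_iff[OF q(1)])
      fix h assume "h \<in> Hom (SET U) K (e ` W) \<and> (\<forall>n. Comp (SET U) K (e ` W) (X n) (p n) h = q n)"
      then have h: "h \<in> K \<rightarrow>\<^sub>E e ` W" "\<And>n k. k \<in> K \<Longrightarrow> p n (h k) = q n k"
        by (auto simp: compose_eq_iff[OF q(1)])
      show "h = (\<lambda>k\<in>K. e (\<lambda>n. q n k))"
      proof (rule PiE_eqI[OF h(1)])
        show "(\<lambda>k\<in>K. e (\<lambda>n. q n k)) \<in> K \<rightarrow>\<^sub>E e ` W" using qW by auto
        fix k assume k: "k \<in> K"
        then obtain s where s: "s \<in> W" "h k = e s" using h(1) by blast
        then have "s = (\<lambda>n. q n k)" using h(2)[OF k] p by auto
        then show "h k = (\<lambda>k\<in>K. e (\<lambda>n. q n k)) k" using s k by simp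
      qed
    qed
  qed
  then show ?thesis by blast
qed

section \<open>Colimits of chains\<close>

definition is_chain_cocone ::
  "'u set set \<Rightarrow> (nat \<Rightarrow> 'u set) \<Rightarrow> (nat \<Rightarrow> 'u \<Rightarrow> 'u) \<Rightarrow> 'u set \<Rightarrow> (nat \<Rightarrow> 'u \<Rightarrow> 'u) \<Rightarrow> bool" where
  "is_chain_cocone U X x A c \<longleftrightarrow> A \<in> U \<and>
     (\<forall>n. c n \<in> X n \<rightarrow>\<^sub>E A) \<and> (\<forall>n. \<forall>a\<in>X n. c (Suc n) (x n a) = c n a)"

definition is_chain_colimit ::
  "'u set set \<Rightarrow> (nat \<Rightarrow> 'u set) \<Rightarrow> (nat \<Rightarrow> 'u \<Rightarrow> 'u) \<Rightarrow> 'u set \<Rightarrow> (nat \<Rightarrow> 'u \<Rightarrow> 'u) \<Rightarrow> bool" where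
  "is_chain_colimit U X x A c \<longleftrightarrow> is_chain_cocone U X x A c \<and>
     (\<forall>Y e. is_chain_cocone U X x Y e \<longrightarrow>
        (\<exists>!h. h \<in> A \<rightarrow>\<^sub>E Y \<and> (\<forall>n. \<forall>a\<in>X n. h (c n a) = e n a)))"

lemma chain_colimit_arrow:
  assumes "is_chain_colimit U X x A c" "is_chain_cocone U X x Y e"
  shows "\<exists>h\<in>A \<rightarrow>\<^sub>E Y. \<forall>n. \<forall>a\<in>X n. h (c n a) = e n a"
proof -
  have "\<exists>!h. h \<in> A \<rightarrow>\<^sub>E Y \<and> (\<forall>n. \<forall>a\<in>X n. h (c n a) = e n a)"
    using assms(1)[unfolded is_chain_colimit_def, THEN conjunct2, rule_format, OF assms(2)] .
  from ex1_implies_ex[OF this] show ?thesis by blast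
qed

definition is_chain :: "'u set set \<Rightarrow> (nat \<Rightarrow> 'u set) \<Rightarrow> (nat \<Rightarrow> 'u \<Rightarrow> 'u) \<Rightarrow> bool" where
  "is_chain U X x \<longleftrightarrow> (\<forall>n. X n \<in> U \<and> x n \<in> X n \<rightarrow>\<^sub>E X (Suc n))"

lemma chain_colimit_cocone:
  assumes "is_chain_colimit U X x A c"
  shows "A \<in> U" and "c n \<in> X n \<rightarrow>\<^sub>E A" and "a \<in> X n \<Longrightarrow> c (Suc n) (x n a) = c n a"
  using assms unfolding is_chain_colimit_def is_chain_cocone_def by auto

text \<open>If \<open>w\<close> were missed by all the injections, two maps that differ only at \<open>w\<close> would induce the
  same cocone.\<close>

lemma chain_colimit_surj:
  fixes U :: "'u set set"
  assumes U: "set_universe U" and X: "is_chain U X x" and A: "is_chain_colimit U X x A c"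
    and w: "w \<in> A"
  shows "\<exists>n. \<exists>a\<in>X n. c n a = w"
proof (rule ccontr)
  assume miss: "\<not> ?thesis"
  obtain \<nu> :: "nat \<Rightarrow> 'u" where \<nu>: "inj \<nu>" "range \<nu> \<in> U"
    using universe_nat[OF U] .
  note c = chain_colimit_cocone[OF A]
  have x_in: "x n a \<in> X (Suc n)" if "a \<in> X n" for n a
    using X that unfolding is_chain_def by blast
  have e: "is_chain_cocone U X x (range \<nu>) (\<lambda>n. \<lambda>a\<in>X n. \<nu> 0)"
    using \<nu>(2) x_in by (auto simp: is_chain_cocone_def)
  have cA: "c n a \<in> A" if "a \<in> X n" for n a using c(2) that by blast
  have "(\<lambda>v\<in>A. \<nu> 0) = (\<lambda>v\<in>A. if v = w then \<nu> 1 else \<nu> 0)"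
    by (rule ex1_unique[OF A[unfolded is_chain_colimit_def, THEN conjunct2, rule_format, OF e]])
      (use cA miss in auto)
  from fun_cong[OF this, of w] show False using w \<nu>(1) by (simp add: inj_eq)
qed

primrec chain_map ::
  "(nat \<Rightarrow> 'u set) \<Rightarrow> (nat \<Rightarrow> 'u \<Rightarrow> 'u) \<Rightarrow> nat \<Rightarrow> nat \<Rightarrow> 'u \<Rightarrow> 'u" where
  "chain_map X x n 0 = (\<lambda>a\<in>X n. a)"
| "chain_map X x n (Suc k) = compose (X n) (x (n + k)) (chain_map X x n k)"

lemma chain_map_PiE:
  assumes "is_chain U X x"
  shows "chain_map X x n k \<in> X n \<rightarrow>\<^sub>E X (n + k)"
proof (induction k)
  case (Suc k)
  then show ?case
    using assms compose_PiE[OF Suc, of "x (n + k)"] by (simp add: is_chain_def)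
qed auto

lemma chain_map_in: "is_chain U X x \<Longrightarrow> a \<in> X n \<Longrightarrow> chain_map X x n k a \<in> X (n + k)"
  using chain_map_PiE by blast

lemma chain_map_add:
  assumes X: "is_chain U X x" and a: "a \<in> X n"
  shows "chain_map X x (n + k) l (chain_map X x n k a) = chain_map X x n (k + l) a"
proof (induction l)
  case 0
  then show ?case using chain_map_in[OF assms] by simp
next
  case (Suc l)
  then show ?case using chain_map_in[OF assms] a by (simp add: compose_eq add.assoc)
qed

lemma chain_map_one: "is_chain U X x \<Longrightarrow> chain_map X x n (Suc 0) = x n"
  by (rule PiE_eqI[where A = "X n"], erule chain_map_PiE) (auto simp: is_chain_def compose_def)

lemma cocone_chain_map:
  assumes X: "is_chain U X x" and c: "is_chain_cocone U X x A c" and a: "a \<in> X n"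
  shows "c (n + k) (chain_map X x n k a) = c n a"
proof (induction k)
  case (Suc k)
  then show ?case using chain_map_in[OF X a] a c
    by (simp add: compose_eq is_chain_cocone_def)
qed (use a in simp)

text \<open>Eventual equality of sequences is an equivalence relation without any appeal to the chain,
  so identifying elements of different stages through it needs no separate proof of transitivity.\<close>

definition germ :: "(nat \<Rightarrow> 'u) \<Rightarrow> (nat \<Rightarrow> 'u) set" where
  "germ s = {t. \<forall>\<^sub>F k in sequentially. t k = s k}"

lemma germ_eq_iff: "germ s = germ t \<longleftrightarrow> (\<forall>\<^sub>F k in sequentially. s k = t k)"
proof
  assume "germ s = germ t"
  moreover have "s \<in> germ s" by (simp add: germ_def)
  ultimately show "\<forall>\<^sub>F k in sequentially. s k = t k" by (simp add: germ_def)
next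
  assume *: "\<forall>\<^sub>F k in sequentially. s k = t k"
  have "(\<forall>\<^sub>F k in sequentially. r k = s k) = (\<forall>\<^sub>F k in sequentially. r k = t k)" for r
    by (rule eventually_cong[OF *]) simp
  then show "germ s = germ t" by (simp add: germ_def)
qed

definition tail :: "(nat \<Rightarrow> 'u set) \<Rightarrow> (nat \<Rightarrow> 'u \<Rightarrow> 'u) \<Rightarrow> nat \<Rightarrow> 'u \<Rightarrow> nat \<Rightarrow> 'u" where
  "tail X x n a k = (if k < n then undefined else chain_map X x n (k - n) a)"

text \<open>The colimit of a chain consists of the germs at infinity of the trajectories of its elements.\<close>

lemma chain_colimit_exists:
  fixes U :: "'u set set"
  assumes U: "set_universe U" and X: "is_chain U X x"
  shows "\<exists>A c. is_chain_colimit U X x A c"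
proof -
  define W where "W = (\<lambda>(n, a). germ (tail X x n a)) ` (SIGMA n:UNIV. X n)"
  have "has_copy U W"
    unfolding W_def
    by (rule has_copy_image[OF U has_copy_Sigma[OF U]]) (use X in \<open>simp add: is_chain_def\<close>)
  then obtain e where e: "inj_on e W" "e ` W \<in> U" unfolding has_copy_def by blast
  define c where "c n = (\<lambda>a\<in>X n. e (germ (tail X x n a)))" for n
  have W: "germ (tail X x n a) \<in> W" if "a \<in> X n" for n a using that by (force simp: W_def)
  have c_in: "c n \<in> X n \<rightarrow>\<^sub>E e ` W" for n using W by (auto simp: c_def)
  have c_eq: "c n a = c m b \<longleftrightarrow> germ (tail X x n a) = germ (tail X x m b)"
    if "a \<in> X n" "b \<in> X m" for n a m b
    using that e(1) W by (auto simp: c_def dest: inj_onD)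
  have x_in: "x n a \<in> X (Suc n)" if "a \<in> X n" for n a
    using X that unfolding is_chain_def by blast
  have "is_chain_cocone U X x (e ` W) c"
    unfolding is_chain_cocone_def
  proof (intro conjI allI ballI)
    fix n a assume a: "a \<in> X n"
    have "tail X x (Suc n) (x n a) k = tail X x n a k" if k: "k \<ge> Suc n" for k
    proof -
      have "chain_map X x (n + Suc 0) (k - Suc n) (chain_map X x n (Suc 0) a)
          = chain_map X x n (Suc 0 + (k - Suc n)) a"
        by (rule chain_map_add[OF X a])
      moreover have "Suc 0 + (k - Suc n) = k - n" using k by simp
      ultimately show ?thesis using k chain_map_one[OF X] by (simp add: tail_def del: chain_map.simps)
    qed
    then have "germ (tail X x (Suc n) (x n a)) = germ (tail X x n a)"
      unfolding germ_eq_iff eventually_sequentially by blast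
    then show "c (Suc n) (x n a) = c n a" using c_eq a x_in by blast
  qed (use e c_in in auto)
  moreover have "\<exists>!h. h \<in> e ` W \<rightarrow>\<^sub>E Y \<and> (\<forall>n. \<forall>a\<in>X n. h (c n a) = y n a)"
    if y: "is_chain_cocone U X x Y y" for Y y
  proof -
    have same: "y n a = y m b" if ab: "a \<in> X n" "b \<in> X m" "c n a = c m b" for n a m b
    proof -
      obtain N where N: "\<And>k. k \<ge> N \<Longrightarrow> tail X x n a k = tail X x m b k"
        using ab c_eq unfolding germ_eq_iff eventually_sequentially by blast
      define k where "k = max N (max n m)"
      have "chain_map X x n (k - n) a = chain_map X x m (k - m) b"
        using N[of k] by (simp add: tail_def k_def)
      then show ?thesis
        using cocone_chain_map[OF X y ab(1), of "k - n"] cocone_chain_map[OF X y ab(2), of "k - m"]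
        by (simp add: k_def)
    qed
    have y_in: "y n a \<in> Y" if "a \<in> X n" for n a
      using y that unfolding is_chain_cocone_def by blast
    have surj: "\<exists>n a. a \<in> X n \<and> w = c n a" if "w \<in> e ` W" for w
      using that by (force simp: W_def c_def)
    define h where "h = (\<lambda>w\<in>e ` W. THE b. \<exists>n a. a \<in> X n \<and> w = c n a \<and> b = y n a)"
    have h: "h (c n a) = y n a" if "a \<in> X n" for n a
    proof -
      have "c n a \<in> e ` W" using c_in that by blast
      moreover have "(THE b. \<exists>m a'. a' \<in> X m \<and> c n a = c m a' \<and> b = y m a') = y n a"
      proof (rule the_equality)
        show "\<exists>m a'. a' \<in> X m \<and> c n a = c m a' \<and> y n a = y m a'" using that by blast
        show "b = y n a" if ex: "\<exists>m a'. a' \<in> X m \<and> c n a = c m a' \<and> b = y m a'" for b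
        proof -
          obtain m a' where a': "a' \<in> X m" "c n a = c m a'" "b = y m a'" using ex by blast
          show ?thesis using same[OF \<open>a \<in> X n\<close> a'(1,2)] a'(3) by simp
        qed
      qed
      ultimately show ?thesis by (simp add: h_def)
    qed
    show ?thesis
    proof (intro ex1I[where a = h] conjI allI ballI)
      show h_in: "h \<in> e ` W \<rightarrow>\<^sub>E Y"
      proof (rule PiE_I)
        fix w assume "w \<in> e ` W"
        then obtain n a where "a \<in> X n" "w = c n a" using surj by blast
        then show "h w \<in> Y" using h y_in by simp
      qed (simp add: h_def)
      show "h (c n a) = y n a" if "a \<in> X n" for n a using h that .
      fix g assume g: "g \<in> e ` W \<rightarrow>\<^sub>E Y \<and> (\<forall>n. \<forall>a\<in>X n. g (c n a) = y n a)"
      show "g = h"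
      proof (rule PiE_eqI[OF g[THEN conjunct1] h_in])
        fix w assume "w \<in> e ` W"
        then obtain n a where "a \<in> X n" "w = c n a" using surj by blast
        then show "g w = h w" using h g by simp
      qed
    qed
  qed
  ultimately show ?thesis unfolding is_chain_colimit_def by blast
qed

section \<open>Finitary functors preserve colimits of chains\<close>

text \<open>The ordered set of natural numbers as a category; \<open>\<nu>\<close> names its objects inside the universe.\<close>

definition omega_cat :: "(nat \<Rightarrow> 'u) \<Rightarrow> ('u, 'u) category" where
  "omega_cat \<nu> =
    \<lparr>Obj = range \<nu>,
     Hom = (\<lambda>i j. if inv \<nu> i \<le> inv \<nu> j then {undefined} else {}),
     Ide = (\<lambda>_. undefined),
     Comp = (\<lambda>_ _ _ _ _. undefined)\<rparr>"

lemma omega_cat_simps [simp]: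
  "Obj (omega_cat \<nu>) = range \<nu>"
  "Hom (omega_cat \<nu>) i j = (if inv \<nu> i \<le> inv \<nu> j then {undefined} else {})"
  "Ide (omega_cat \<nu>) i = undefined"
  "Comp (omega_cat \<nu>) i j k g f = undefined"
  by (simp_all add: omega_cat_def)

lemma is_category_omega_cat: "is_category (omega_cat \<nu>)"
  by (auto simp: is_category_def split: if_splits)

lemma omega_cat_small:
  assumes "set_universe U" "range \<nu> \<in> U"
  shows "is_small_category U (omega_cat \<nu>)"
  using assms is_category_omega_cat universe_empty universe_singleton
  by (auto simp: is_small_category_def)

lemma omega_cat_filtered:
  assumes "inj \<nu>"
  shows "is_filtered (omega_cat \<nu>)"
  unfolding is_filtered_def
proof (intro conjI ballI)
  show "\<exists>k\<in>Obj (omega_cat \<nu>). Hom (omega_cat \<nu>) i k \<noteq> {} \<and> Hom (omega_cat \<nu>) j k \<noteq> {}"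
    for i j
    by (rule bexI[where x = "\<nu> (max (inv \<nu> i) (inv \<nu> j))"]) (use assms in auto)
  show "\<exists>k\<in>Obj (omega_cat \<nu>). \<exists>h\<in>Hom (omega_cat \<nu>) j k.
      Comp (omega_cat \<nu>) i j k h f = Comp (omega_cat \<nu>) i j k h g"
    if "j \<in> Obj (omega_cat \<nu>)" for i j f g
    by (rule bexI[where x = j]) (use that in auto)
qed (use is_category_omega_cat in auto)

text \<open>Every arrow of the diagram is a composite of steps from \<open>n\<close> to \<open>n + 1\<close>, so compatibility with
  the steps suffices.\<close>

lemma cocone_omega_iff:
  assumes \<nu>: "inj \<nu>" and D: "is_functor (omega_cat \<nu>) (SET U) D"
  shows "is_cocone (omega_cat \<nu>) (SET U) D A c \<longleftrightarrow>
    is_chain_cocone U (\<lambda>n. FObj D (\<nu> n)) (\<lambda>n. FMap D (\<nu> n) (\<nu> (Suc n)) undefined) A (\<lambda>n. c (\<nu> n))"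
    (is "?L \<longleftrightarrow> ?R")
proof
  assume L: ?L
  then have c: "c (\<nu> n) \<in> FObj D (\<nu> n) \<rightarrow>\<^sub>E A" for n
    by (auto simp: is_cocone_def)
  have "compose (FObj D (\<nu> n)) (c (\<nu> (Suc n))) (FMap D (\<nu> n) (\<nu> (Suc n)) undefined) = c (\<nu> n)" for n
    using L \<nu> by (simp add: is_cocone_def)
  then show ?R
    using L c unfolding is_chain_cocone_def compose_eq_iff[OF c] by (auto simp: is_cocone_def)
next
  assume R: ?R
  then have c: "c (\<nu> n) \<in> FObj D (\<nu> n) \<rightarrow>\<^sub>E A" for n
    by (auto simp: is_chain_cocone_def)
  have "c (\<nu> (n + k)) (FMap D (\<nu> n) (\<nu> (n + k)) undefined a) = c (\<nu> n) a" if a: "a \<in> FObj D (\<nu> n)"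
    for n k a
  proof (induction k)
    case 0
    have "FMap D (\<nu> n) (\<nu> n) undefined = (\<lambda>a\<in>FObj D (\<nu> n). a)"
      using D unfolding is_functor_def by simp
    then show ?case using a by simp
  next
    case (Suc k)
    have "FMap D (\<nu> n) (\<nu> (n + k)) undefined \<in> FObj D (\<nu> n) \<rightarrow>\<^sub>E FObj D (\<nu> (n + k))"
      using D \<nu> unfolding is_functor_def by simp
    then have "FMap D (\<nu> n) (\<nu> (n + k)) undefined a \<in> FObj D (\<nu> (n + k))" using a by blast
    moreover have "FMap D (\<nu> n) (\<nu> (Suc (n + k))) undefined =
        compose (FObj D (\<nu> n)) (FMap D (\<nu> (n + k)) (\<nu> (Suc (n + k))) undefined)
          (FMap D (\<nu> n) (\<nu> (n + k)) undefined)"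
    proof -
      have "\<forall>f\<in>Hom (omega_cat \<nu>) (\<nu> n) (\<nu> (n + k)). \<forall>g\<in>Hom (omega_cat \<nu>) (\<nu> (n + k)) (\<nu> (Suc (n + k))).
        FMap D (\<nu> n) (\<nu> (Suc (n + k))) (Comp (omega_cat \<nu>) (\<nu> n) (\<nu> (n + k)) (\<nu> (Suc (n + k))) g f) =
        Comp (SET U) (FObj D (\<nu> n)) (FObj D (\<nu> (n + k))) (FObj D (\<nu> (Suc (n + k))))
          (FMap D (\<nu> (n + k)) (\<nu> (Suc (n + k))) g) (FMap D (\<nu> n) (\<nu> (n + k)) f)"
        using D[unfolded is_functor_def, THEN conjunct2, THEN conjunct2, THEN conjunct2]
        by (auto simp del: SET_simps)
      then show ?thesis using \<nu> by simp
    qed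
    ultimately show ?case using Suc a R by (simp add: is_chain_cocone_def compose_eq)
  qed
  then have "compose (FObj D (\<nu> n)) (c (\<nu> m)) (FMap D (\<nu> n) (\<nu> m) undefined) = c (\<nu> n)"
    if "n \<le> m" for n m
    using that le_Suc_ex compose_eq_iff[OF c] by blast
  then show ?L
    using R c \<nu> by (auto simp: is_cocone_def is_chain_cocone_def)
qed

lemma colimit_omega_iff:
  assumes \<nu>: "inj \<nu>" and D: "is_functor (omega_cat \<nu>) (SET U) D"
  shows "is_colimit (omega_cat \<nu>) (SET U) D A c \<longleftrightarrow>
    is_chain_colimit U (\<lambda>n. FObj D (\<nu> n)) (\<lambda>n. FMap D (\<nu> n) (\<nu> (Suc n)) undefined) A (\<lambda>n. c (\<nu> n))"
    (is "_ \<longleftrightarrow> is_chain_colimit U ?X ?x A ?c")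
proof -
  note iff = cocone_omega_iff[OF \<nu> D]
  have mediates: "(\<forall>i\<in>Obj (omega_cat \<nu>). Comp (SET U) (FObj D i) A Y h (c i) = e i)
      \<longleftrightarrow> (\<forall>n. \<forall>a\<in>?X n. h (?c n a) = e (\<nu> n) a)"
    if "is_cocone (omega_cat \<nu>) (SET U) D Y e" for Y e h
  proof -
    have e: "e (\<nu> n) \<in> ?X n \<rightarrow>\<^sub>E Y" for n
      using that by (auto simp: is_cocone_def)
    show ?thesis by (simp add: compose_eq_iff[OF e])
  qed
  show ?thesis
  proof
    assume L: "is_colimit (omega_cat \<nu>) (SET U) D A c"
    show "is_chain_colimit U ?X ?x A ?c"
      unfolding is_chain_colimit_def
    proof (intro conjI allI impI)
      show "is_chain_cocone U ?X ?x A ?c" by (rule L[unfolded is_colimit_def, THEN conjunct1, unfolded iff])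
      fix Y e assume "is_chain_cocone U ?X ?x Y e"
      then have *: "is_cocone (omega_cat \<nu>) (SET U) D Y (e \<circ> inv \<nu>)"
        using iff \<nu> by simp
      then have "\<exists>!h. h \<in> Hom (SET U) A Y \<and>
          (\<forall>i\<in>Obj (omega_cat \<nu>). Comp (SET U) (FObj D i) A Y h (c i) = (e \<circ> inv \<nu>) i)"
        by (rule L[unfolded is_colimit_def, THEN conjunct2, rule_format])
      then show "\<exists>!h. h \<in> A \<rightarrow>\<^sub>E Y \<and> (\<forall>n. \<forall>a\<in>?X n. h (?c n a) = e n a)"
        unfolding mediates[OF *] using \<nu> by simp
    qed
  next
    assume R: "is_chain_colimit U ?X ?x A ?c"
    show "is_colimit (omega_cat \<nu>) (SET U) D A c"
      unfolding is_colimit_def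
    proof (intro conjI allI impI)
      show "is_cocone (omega_cat \<nu>) (SET U) D A c" unfolding iff by (rule R[unfolded is_chain_colimit_def, THEN conjunct1])
      fix Y e assume *: "is_cocone (omega_cat \<nu>) (SET U) D Y e"
      then have "\<exists>!h. h \<in> A \<rightarrow>\<^sub>E Y \<and> (\<forall>n. \<forall>a\<in>?X n. h (?c n a) = e (\<nu> n) a)"
        unfolding iff by (rule R[unfolded is_chain_colimit_def, THEN conjunct2, rule_format])
      then show "\<exists>!h. h \<in> Hom (SET U) A Y \<and>
          (\<forall>i\<in>Obj (omega_cat \<nu>). Comp (SET U) (FObj D i) A Y h (c i) = e i)"
        unfolding mediates[OF *] by simp
    qed
  qed
qed

definition chain_diagram ::
  "(nat \<Rightarrow> 'u) \<Rightarrow> (nat \<Rightarrow> 'u set) \<Rightarrow> (nat \<Rightarrow> 'u \<Rightarrow> 'u) \<Rightarrow> ('u, 'u, 'u set, 'u \<Rightarrow> 'u) funct" where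
  "chain_diagram \<nu> X x =
    \<lparr>FObj = (\<lambda>i. X (inv \<nu> i)),
     FMap = (\<lambda>i j _. chain_map X x (inv \<nu> i) (inv \<nu> j - inv \<nu> i))\<rparr>"

lemma chain_diagram_functor:
  assumes \<nu>: "inj \<nu>" and X: "is_chain U X x"
  shows "is_functor (omega_cat \<nu>) (SET U) (chain_diagram \<nu> X x)"
proof -
  have arr: "chain_map X x n (m - n) \<in> X n \<rightarrow>\<^sub>E X m" if "n \<le> m" for n m
    using chain_map_PiE[OF X, of n "m - n"] that by simp
  have comp: "compose (X n) (chain_map X x m (k - m)) (chain_map X x n (m - n)) = chain_map X x n (k - n)"
    if le: "n \<le> m" "m \<le> k" for n m k
  proof (subst compose_eq_iff[OF arr], safe)
    show "n \<le> k" using le by simp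
    fix a assume "a \<in> X n"
    from chain_map_add[OF X this, of "m - n" "k - m"]
    show "chain_map X x m (k - m) (chain_map X x n (m - n) a) = chain_map X x n (k - n) a"
      using le by simp
  qed
  show ?thesis
    unfolding is_functor_def chain_diagram_def
    using X arr by (auto simp: \<nu> comp is_chain_def split: if_splits)
qed

lemma comp_functor:
  assumes "is_functor C D F" "is_functor D E G"
  shows "is_functor C E (G \<circ>\<^sub>F F)"
  using assms unfolding is_functor_def comp_funct_def by simp

text \<open>A chain is a diagram on a small filtered category, so this is an instance of finitarity.\<close>

lemma finitary_chain_colimit:
  fixes U :: "'u set set"
  assumes U: "set_universe U" and F: "is_functor (SET U) (SET U) F" "finitary U F"
    and X: "is_chain U X x" and A: "is_chain_colimit U X x A c"
  shows "is_chain_colimit U (\<lambda>n. FObj F (X n)) (\<lambda>n. FMap F (X n) (X (Suc n)) (x n))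
    (FObj F A) (\<lambda>n. FMap F (X n) A (c n))"
proof -
  obtain \<nu> :: "nat \<Rightarrow> 'u" where \<nu>: "inj \<nu>" "range \<nu> \<in> U"
    using universe_nat[OF U] .
  let ?D = "chain_diagram \<nu> X x"
  note D = chain_diagram_functor[OF \<nu>(1) X]
  have node: "FObj ?D (\<nu> n) = X n" "FMap ?D (\<nu> n) (\<nu> (Suc n)) undefined = x n" for n
    using \<nu>(1) chain_map_one[OF X] by (simp_all add: chain_diagram_def del: chain_map.simps)
  have "is_colimit (omega_cat \<nu>) (SET U) ?D A (c \<circ> inv \<nu>)"
    unfolding colimit_omega_iff[OF \<nu>(1) D] node using A \<nu>(1) by simp
  then have "is_colimit (omega_cat \<nu>) (SET U) (F \<circ>\<^sub>F ?D) (FObj F A)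
      (\<lambda>i. FMap F (FObj ?D i) A ((c \<circ> inv \<nu>) i))"
    using F(2) omega_cat_small[OF U \<nu>(2)] omega_cat_filtered[OF \<nu>(1)] D
    unfolding finitary_def by blast
  then show ?thesis
    unfolding colimit_omega_iff[OF \<nu>(1) comp_functor[OF D F(1)]]
    using node \<nu>(1) by (simp add: comp_funct_def)
qed

section \<open>The initial algebra as the colimit of the initial chain\<close>

primrec init_obj :: "('u set, 'u \<Rightarrow> 'u) endofunct \<Rightarrow> nat \<Rightarrow> 'u set" where
  "init_obj F 0 = {}"
| "init_obj F (Suc n) = FObj F (init_obj F n)"

primrec init_map :: "('u set, 'u \<Rightarrow> 'u) endofunct \<Rightarrow> nat \<Rightarrow> 'u \<Rightarrow> 'u" where
  "init_map F 0 = (\<lambda>_. undefined)"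
| "init_map F (Suc n) = FMap F (init_obj F n) (init_obj F (Suc n)) (init_map F n)"

text \<open>The cocone that an algebra \<open>\<beta> : F B \<rightarrow> B\<close> induces on the initial chain by iterating \<open>\<beta>\<close>.  For
  the initial algebra it is the colimit cocone, which describes the injections without fixing
  a construction of the colimit.\<close>

primrec fold_map ::
  "('u set, 'u \<Rightarrow> 'u) endofunct \<Rightarrow> 'u set \<Rightarrow> ('u \<Rightarrow> 'u) \<Rightarrow> nat \<Rightarrow> 'u \<Rightarrow> 'u" where
  "fold_map F B \<beta> 0 = (\<lambda>_. undefined)"
| "fold_map F B \<beta> (Suc n) = compose (init_obj F (Suc n)) \<beta> (FMap F (init_obj F n) B (fold_map F B \<beta> n))"

definition alg_hom ::
  "('u set, 'u \<Rightarrow> 'u) endofunct \<Rightarrow> 'u set \<Rightarrow> ('u \<Rightarrow> 'u) \<Rightarrow> 'u set \<Rightarrow> ('u \<Rightarrow> 'u) \<Rightarrow> ('u \<Rightarrow> 'u) \<Rightarrow> bool" where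
  "alg_hom F A \<alpha> B \<beta> h \<longleftrightarrow> h \<in> A \<rightarrow>\<^sub>E B \<and> (\<forall>a\<in>FObj F A. h (\<alpha> a) = \<beta> (FMap F A B h a))"

lemma initial_algebra_iff:
  "is_initial_algebra (SET U) F A \<alpha> \<longleftrightarrow> A \<in> U \<and> \<alpha> \<in> FObj F A \<rightarrow>\<^sub>E A \<and>
     (\<forall>B\<in>U. \<forall>\<beta>\<in>FObj F B \<rightarrow>\<^sub>E B. \<exists>!h. alg_hom F A \<alpha> B \<beta> h)"
  by (simp add: is_initial_algebra_def alg_hom_def compose_eq_compose_iff)

context set_functor
begin

lemma init_chain: "is_chain U (init_obj F) (init_map F)"
proof -
  have X: "init_obj F n \<in> U" for n
    by (induction n) (simp_all add: universe_empty[OF universe] obj)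
  have "init_map F n \<in> init_obj F n \<rightarrow>\<^sub>E init_obj F (Suc n)" for n
  proof (induction n)
    case (Suc n)
    show ?case unfolding init_map.simps init_obj.simps(2)[of F n] init_obj.simps(2)[of F "Suc n"]
      by (rule arr[OF X X[of "Suc n", unfolded init_obj.simps(2)] Suc[unfolded init_obj.simps(2)]])
  qed simp
  with X show ?thesis by (simp add: is_chain_def)
qed

lemma init_obj_in: "init_obj F n \<in> U"
  and init_map_in: "init_map F n \<in> init_obj F n \<rightarrow>\<^sub>E init_obj F (Suc n)"
  using init_chain unfolding is_chain_def by blast+

lemma fold_map_in:
  assumes "B \<in> U" "\<beta> \<in> FObj F B \<rightarrow>\<^sub>E B"
  shows "fold_map F B \<beta> n \<in> init_obj F n \<rightarrow>\<^sub>E B"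
proof (induction n)
  case (Suc n)
  show ?case
    unfolding fold_map.simps by (rule compose_PiE[OF _ assms(2)]) (simp add: arr init_obj_in assms(1) Suc)
qed simp

lemma fold_map_Suc:
  "a \<in> FObj F (init_obj F n) \<Longrightarrow> fold_map F B \<beta> (Suc n) a = \<beta> (FMap F (init_obj F n) B (fold_map F B \<beta> n) a)"
  by (simp add: compose_eq)

lemma fold_map_cocone:
  assumes "B \<in> U" "\<beta> \<in> FObj F B \<rightarrow>\<^sub>E B"
  shows "is_chain_cocone U (init_obj F) (init_map F) B (fold_map F B \<beta>)"
proof -
  have "fold_map F B \<beta> (Suc n) (init_map F n a) = fold_map F B \<beta> n a" if "a \<in> init_obj F n" for n a
    using that
  proof (induction n arbitrary: a)
    case (Suc n)
    have a: "a \<in> FObj F (init_obj F n)" using Suc.prems by simp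
    have "init_map F (Suc n) a \<in> FObj F (init_obj F (Suc n))"
      using init_map_in[of "Suc n"] Suc.prems by auto
    then have "fold_map F B \<beta> (Suc (Suc n)) (init_map F (Suc n) a)
        = \<beta> (FMap F (init_obj F (Suc n)) B (fold_map F B \<beta> (Suc n)) (init_map F (Suc n) a))"
      by (rule fold_map_Suc)
    also have "FMap F (init_obj F (Suc n)) B (fold_map F B \<beta> (Suc n)) (init_map F (Suc n) a)
        = FMap F (init_obj F n) B (fold_map F B \<beta> n) a"
      unfolding init_map.simps
      by (rule triangle[OF init_obj_in init_obj_in assms(1) init_map_in fold_map_in[OF assms]
            fold_map_in[OF assms] Suc.IH a])
    also have "\<beta> \<dots> = fold_map F B \<beta> (Suc n) a" by (rule fold_map_Suc[OF a, symmetric])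
    finally show ?case .
  qed simp
  then show ?thesis
    using assms(1) fold_map_in[OF assms] unfolding is_chain_cocone_def by blast
qed

lemma alg_hom_fold_map:
  assumes A: "A \<in> U" "\<alpha> \<in> FObj F A \<rightarrow>\<^sub>E A" and B: "B \<in> U" "\<beta> \<in> FObj F B \<rightarrow>\<^sub>E B"
    and h: "alg_hom F A \<alpha> B \<beta> h" and a: "a \<in> init_obj F n"
  shows "h (fold_map F A \<alpha> n a) = fold_map F B \<beta> n a"
  using a
proof (induction n arbitrary: a)
  case (Suc n)
  have a: "a \<in> FObj F (init_obj F n)" using Suc.prems by simp
  have h': "h \<in> A \<rightarrow>\<^sub>E B" "\<And>a. a \<in> FObj F A \<Longrightarrow> h (\<alpha> a) = \<beta> (FMap F A B h a)"
    using h by (auto simp: alg_hom_def)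
  have "FMap F (init_obj F n) A (fold_map F A \<alpha> n) a \<in> FObj F A"
    by (rule app[OF init_obj_in A(1) fold_map_in[OF A] a])
  then have "h (fold_map F A \<alpha> (Suc n) a)
      = \<beta> (FMap F A B h (FMap F (init_obj F n) A (fold_map F A \<alpha> n) a))"
    unfolding fold_map_Suc[OF a] by (rule h'(2))
  also have "\<dots> = fold_map F B \<beta> (Suc n) a"
    unfolding fold_map_Suc[OF a]
    by (rule arg_cong[where f = \<beta>], rule triangle[OF init_obj_in A(1) B(1) fold_map_in[OF A] h'(1) fold_map_in[OF B] Suc.IH a])
  finally show ?case .
qed simp

text \<open>As \<open>F\<close> preserves the colimit, \<open>F A\<close> is the colimit of the chain without its first stage, and
  the injections into \<open>A\<close> from the later stages induce \<open>F A \<rightarrow> A\<close>.  A morphism to another algebra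
  \<open>(B, \<beta>)\<close> must send the injections to the cocone induced by \<open>\<beta>\<close>, which determines it.\<close>

lemma initial_algebra_of_colimit:
  assumes fin: "finitary U F" and A: "is_chain_colimit U (init_obj F) (init_map F) A c"
  shows "\<exists>\<alpha>. is_initial_algebra (SET U) F A \<alpha> \<and> fold_map F A \<alpha> = c"
proof -
  note c = chain_colimit_cocone[OF A]
  have FA: "is_chain_colimit U (\<lambda>n. FObj F (init_obj F n)) (\<lambda>n. init_map F (Suc n))
    (FObj F A) (\<lambda>n. FMap F (init_obj F n) A (c n))"
    using finitary_chain_colimit[OF universe is_funct fin init_chain A] by simp
  have "is_chain_cocone U (\<lambda>n. FObj F (init_obj F n)) (\<lambda>n. init_map F (Suc n)) A (\<lambda>n. c (Suc n))"
    unfolding is_chain_cocone_def init_obj.simps(2)[symmetric]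
    using c(1) c(2)[of "Suc _"] c(3)[of _ "Suc _"] by (intro conjI allI ballI)
  from chain_colimit_arrow[OF FA this]
  obtain \<alpha> where \<alpha>_in: "\<alpha> \<in> FObj F A \<rightarrow>\<^sub>E A" and
    \<alpha>_c: "\<forall>n. \<forall>a\<in>FObj F (init_obj F n). \<alpha> (FMap F (init_obj F n) A (c n) a) = c (Suc n) a"
    by (elim bexE)
  note \<alpha> = \<alpha>_in \<alpha>_c[rule_format]
  have fold: "fold_map F A \<alpha> n = c n" for n
  proof (induction n)
    case 0
    show ?case by (rule PiE_eqI[OF fold_map_in[OF c(1) \<alpha>(1)] c(2)]) simp
  next
    case (Suc n)
    show ?case
      by (rule PiE_eqI[OF fold_map_in[OF c(1) \<alpha>(1)] c(2)]) (simp add: compose_eq Suc \<alpha>(2))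
  qed
  have FA_surj: "\<exists>n. \<exists>a\<in>FObj F (init_obj F n). FMap F (init_obj F n) A (c n) a = w" if "w \<in> FObj F A" for w
  proof -
    have "is_chain U (\<lambda>n. FObj F (init_obj F n)) (\<lambda>n. init_map F (Suc n))"
      using init_obj_in init_map_in obj unfolding is_chain_def
      by (metis init_obj.simps(2))
    from chain_colimit_surj[OF universe this FA that] show ?thesis .
  qed
  have "\<exists>!h. alg_hom F A \<alpha> B \<beta> h" if B: "B \<in> U" "\<beta> \<in> FObj F B \<rightarrow>\<^sub>E B" for B \<beta>
  proof -
    from chain_colimit_arrow[OF A fold_map_cocone[OF B]]
    obtain h where h_in: "h \<in> A \<rightarrow>\<^sub>E B" and
      h_c: "\<forall>n. \<forall>a\<in>init_obj F n. h (c n a) = fold_map F B \<beta> n a"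
      by (elim bexE)
    note h = h_in h_c[rule_format]
    have hom: "h (\<alpha> w) = \<beta> (FMap F A B h w)" if "w \<in> FObj F A" for w
    proof -
      obtain n a where a: "a \<in> FObj F (init_obj F n)" and w: "w = FMap F (init_obj F n) A (c n) a"
        using FA_surj \<open>w \<in> FObj F A\<close> by blast
      have "FMap F A B h w = FMap F (init_obj F n) B (fold_map F B \<beta> n) a"
        unfolding w by (rule triangle[OF init_obj_in c(1) B(1) c(2) h(1) fold_map_in[OF B] h(2) a])
      moreover have "h (\<alpha> w) = fold_map F B \<beta> (Suc n) a"
        unfolding w \<alpha>(2)[OF a] by (rule h(2)) (use a in simp)
      ultimately show ?thesis by (simp add: fold_map_Suc[OF a] del: fold_map.simps)
    qed
    have unique: "g = h" if g: "alg_hom F A \<alpha> B \<beta> g" for g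
    proof (rule PiE_eqI[where A = A and B = B and C = B])
      show "g \<in> A \<rightarrow>\<^sub>E B" "h \<in> A \<rightarrow>\<^sub>E B" using g h(1) by (simp_all add: alg_hom_def)
      fix w assume "w \<in> A"
      then obtain n a where a: "a \<in> init_obj F n" and w: "w = c n a"
        using chain_colimit_surj[OF universe init_chain A] by blast
      show "g w = h w"
        unfolding w h(2)[OF a] using alg_hom_fold_map[OF c(1) \<alpha>(1) B g a] fold by simp
    qed
    show ?thesis
      using h(1) hom unique by (intro ex1I[where a = h]) (auto simp: alg_hom_def)
  qed
  then have "is_initial_algebra (SET U) F A \<alpha>"
    using c(1) \<alpha>(1) by (simp add: initial_algebra_iff)
  with fold show ?thesis by blast
qed

lemma initial_algebra_exists:
  assumes "finitary U F"
  shows "\<exists>A \<alpha>. is_initial_algebra (SET U) F A \<alpha>"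
  using chain_colimit_exists[OF universe init_chain] initial_algebra_of_colimit[OF assms] by blast

lemma alg_hom_comp:
  assumes A: "A \<in> U" "\<alpha> \<in> FObj F A \<rightarrow>\<^sub>E A" and B: "B \<in> U" "\<beta> \<in> FObj F B \<rightarrow>\<^sub>E B"
    and C: "C \<in> U" "\<gamma> \<in> FObj F C \<rightarrow>\<^sub>E C"
    and f: "alg_hom F A \<alpha> B \<beta> f" and g: "alg_hom F B \<beta> C \<gamma> g"
  shows "alg_hom F A \<alpha> C \<gamma> (compose A g f)"
proof -
  have f': "f \<in> A \<rightarrow>\<^sub>E B" and g': "g \<in> B \<rightarrow>\<^sub>E C" using f g by (auto simp: alg_hom_def)
  have "g (f (\<alpha> a)) = \<gamma> (FMap F A C (compose A g f) a)" if a: "a \<in> FObj F A" for a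
  proof -
    have "FMap F B C g (FMap F A B f a) = FMap F A C (compose A g f) a"
      by (rule triangle[OF A(1) B(1) C(1) f' g' compose_PiE[OF f' g'] _ a]) (simp add: compose_eq)
    moreover have "g (f (\<alpha> a)) = \<gamma> (FMap F B C g (FMap F A B f a))"
      using f g a app[OF A(1) B(1) f' a] by (simp add: alg_hom_def)
    ultimately show ?thesis by simp
  qed
  moreover have "\<alpha> a \<in> A" if "a \<in> FObj F A" for a using A(2) that by blast
  ultimately show ?thesis using compose_PiE[OF f' g'] by (simp add: alg_hom_def compose_eq)
qed

lemma alg_hom_id:
  assumes "A \<in> U" "\<alpha> \<in> FObj F A \<rightarrow>\<^sub>E A"
  shows "alg_hom F A \<alpha> A \<alpha> (\<lambda>a\<in>A. a)"
proof -
  have "FMap F A A (\<lambda>a\<in>A. a) w = w" if "w \<in> FObj F A" for w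
    using is_funct assms(1) that unfolding is_functor_def by simp
  then show ?thesis using assms(2) by (auto simp: alg_hom_def PiE_mem)
qed

lemma initial_algebra_endo:
  assumes A: "is_initial_algebra (SET U) F A \<alpha>" and h: "alg_hom F A \<alpha> A \<alpha> h" and a: "a \<in> A"
  shows "h a = a"
proof -
  have A': "A \<in> U" "\<alpha> \<in> FObj F A \<rightarrow>\<^sub>E A" and ex1: "\<exists>!h. alg_hom F A \<alpha> A \<alpha> h"
    using A by (auto simp: initial_algebra_iff)
  have "h = (\<lambda>a\<in>A. a)" by (rule ex1_unique[of "alg_hom F A \<alpha> A \<alpha>", OF ex1 h alg_hom_id[OF A']])
  with a show ?thesis by simp
qed

lemma Lambek:
  assumes A: "is_initial_algebra (SET U) F A \<alpha>"
  shows "bij_betw \<alpha> (FObj F A) A"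
proof -
  have A': "A \<in> U" "\<alpha> \<in> FObj F A \<rightarrow>\<^sub>E A" using A by (simp_all add: initial_algebra_iff)
  note FA = obj[OF A'(1)] arr[OF obj[OF A'(1)] A'(1,2)]
  obtain h where h: "alg_hom F A \<alpha> (FObj F A) (FMap F (FObj F A) A \<alpha>) h"
    using A[unfolded initial_algebra_iff, THEN conjunct2, THEN conjunct2, rule_format, OF FA]
    by (rule ex1_implies_ex[THEN exE])
  then have h': "h \<in> A \<rightarrow>\<^sub>E FObj F A"
    "\<And>a. a \<in> FObj F A \<Longrightarrow> h (\<alpha> a) = FMap F (FObj F A) A \<alpha> (FMap F A (FObj F A) h a)"
    by (auto simp: alg_hom_def)
  have "alg_hom F (FObj F A) (FMap F (FObj F A) A \<alpha>) A \<alpha> \<alpha>"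
    using A'(2) by (simp add: alg_hom_def)
  from initial_algebra_endo[OF A alg_hom_comp[OF A' FA A' h this]]
  have \<alpha>h: "\<alpha> (h a) = a" if "a \<in> A" for a using that by (simp add: compose_eq)
  have "h (\<alpha> a) = a" if "a \<in> FObj F A" for a
    unfolding h'(2)[OF that] by (rule retract[OF A'(1) FA(1) h'(1) A'(2) \<alpha>h that])
  then show ?thesis
    by (intro bij_betw_byWitness[where f' = h]) (use \<alpha>h A'(2) h'(1) in auto)
qed

text \<open>By uniqueness of the initial algebra up to isomorphism, this need only be seen for the
  algebra that is built as a colimit.\<close>

lemma initial_algebra_jointly_surj:
  assumes fin: "finitary U F" and G: "is_functor (SET U) (SET U) G" "finitary U G"
    and A: "is_initial_algebra (SET U) F A \<alpha>" and w: "w \<in> FObj G A"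
  shows "\<exists>n. \<exists>z\<in>FObj G (init_obj F n). FMap G (init_obj F n) A (fold_map F A \<alpha> n) z = w"
proof -
  interpret G: set_functor U G using universe G(1) by unfold_locales
  have A': "A \<in> U" "\<alpha> \<in> FObj F A \<rightarrow>\<^sub>E A" using A by (simp_all add: initial_algebra_iff)
  obtain C c where C: "is_chain_colimit U (init_obj F) (init_map F) C c"
    using chain_colimit_exists[OF universe init_chain] by blast
  obtain \<gamma> where \<gamma>: "is_initial_algebra (SET U) F C \<gamma>" "fold_map F C \<gamma> = c"
    using initial_algebra_of_colimit[OF fin C] by blast
  have C': "C \<in> U" "\<gamma> \<in> FObj F C \<rightarrow>\<^sub>E C" using \<gamma>(1) by (simp_all add: initial_algebra_iff)
  obtain g h where g: "alg_hom F A \<alpha> C \<gamma> g" and h: "alg_hom F C \<gamma> A \<alpha> h"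
    using A \<gamma>(1) by (metis initial_algebra_iff)
  have gh: "g \<in> A \<rightarrow>\<^sub>E C" "h \<in> C \<rightarrow>\<^sub>E A" using g h by (auto simp: alg_hom_def)
  have hg: "h (g a) = a" if "a \<in> A" for a
    using initial_algebra_endo[OF A alg_hom_comp[OF A' C' A' g h] that] that by (simp add: compose_eq)
  have "is_chain U (\<lambda>n. FObj G (init_obj F n))
      (\<lambda>n. FMap G (init_obj F n) (init_obj F (Suc n)) (init_map F n))"
    unfolding is_chain_def using G.obj[OF init_obj_in] G.arr[OF init_obj_in init_obj_in init_map_in] by blast
  from chain_colimit_surj[OF universe this finitary_chain_colimit[OF universe G init_chain C]
      G.app[OF A'(1) C'(1) gh(1) w]]
  obtain n z where z: "z \<in> FObj G (init_obj F n)"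
    "FMap G (init_obj F n) C (c n) z = FMap G A C g w" by blast
  have "w = FMap G C A h (FMap G A C g w)"
    by (rule G.retract[OF A'(1) C'(1) gh hg w, symmetric])
  also have "\<dots> = FMap G (init_obj F n) A (fold_map F A \<alpha> n) z"
    unfolding z(2)[symmetric]
    by (rule G.triangle[OF init_obj_in C'(1) A'(1) _ gh(2) fold_map_in[OF A'] _ z(1)])
      (use chain_colimit_cocone(2)[OF C] alg_hom_fold_map[OF C' A' h] \<gamma>(2) in auto)
  finally show ?thesis using z(1) by blast
qed

end

section \<open>The final coalgebra as the limit of the final sequence\<close>

text \<open>What an element of a coalgebra shows of itself after \<open>n\<close> steps.  For any coalgebra this is a
  cone over the final sequence, and the morphism into the final coalgebra is the map it induces.\<close>

primrec observe ::
  "('u set, 'u \<Rightarrow> 'u) endofunct \<Rightarrow> 'u set \<Rightarrow> ('u \<Rightarrow> 'u) \<Rightarrow> nat \<Rightarrow> 'u \<Rightarrow> 'u" where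
  "observe F B \<beta> 0 = to_one B"
| "observe F B \<beta> (Suc n) = compose B (FMap F B (fin_obj F n) (observe F B \<beta> n)) \<beta>"

context set_functor
begin

lemma fin_obj_in: "fin_obj F n \<in> U"
  by (induction n) (simp_all add: universe_one[OF universe] obj)

lemma fin_map_in: "fin_map F n \<in> fin_obj F (Suc n) \<rightarrow>\<^sub>E fin_obj F n"
proof (induction n)
  case 0
  show ?case using to_one_PiE by simp
next
  case (Suc n)
  from arr[OF fin_obj_in fin_obj_in this] show ?case by simp
qed

lemma final_seq_limit_exists: "\<exists>L p. final_seq_limit U F L p"
  unfolding final_seq_limit_def by (rule chain_limit_exists[OF universe fin_obj_in])

lemma observe_in:
  assumes "B \<in> U" "\<beta> \<in> B \<rightarrow>\<^sub>E FObj F B"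
  shows "observe F B \<beta> n \<in> B \<rightarrow>\<^sub>E fin_obj F n"
proof (induction n)
  case 0
  show ?case using to_one_PiE by simp
next
  case (Suc n)
  show ?case
    unfolding observe.simps fin_obj.simps
    by (rule compose_PiE[OF assms(2)]) (rule arr[OF assms(1) fin_obj_in Suc])
qed

lemma observe_Suc: "b \<in> B \<Longrightarrow> observe F B \<beta> (Suc n) b = FMap F B (fin_obj F n) (observe F B \<beta> n) (\<beta> b)"
  by (simp add: compose_eq)

lemma observe_compat:
  assumes B: "B \<in> U" "\<beta> \<in> B \<rightarrow>\<^sub>E FObj F B" and b: "b \<in> B"
  shows "fin_map F n (observe F B \<beta> (Suc n) b) = observe F B \<beta> n b"
  using b
proof (induction n arbitrary: b)
  case 0
  show ?case
    using PiE_mem[OF fin_map_in[of 0] PiE_mem[OF observe_in[OF B, of "Suc 0"] 0]]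
      PiE_mem[OF observe_in[OF B, of 0] 0]
    unfolding fin_obj.simps(1) by (rule one_unique)
next
  case (Suc n)
  have \<beta>b: "\<beta> b \<in> FObj F B" using B(2) Suc.prems by blast
  show ?case
    unfolding observe_Suc[OF Suc.prems] fin_map.simps
    by (rule triangle[OF B(1) fin_obj_in fin_obj_in observe_in[OF B] fin_map_in observe_in[OF B] Suc.IH \<beta>b])
qed

end

locale final_sequence = set_functor U H
  for U :: "'u set set" and H :: "('u set, 'u \<Rightarrow> 'u) endofunct" +
  fixes L :: "'u set" and p :: "nat \<Rightarrow> 'u \<Rightarrow> 'u"
  assumes continuous: "omega_op_continuous (SET U) H" and limit: "final_seq_limit U H L p"
begin

lemma limit': "is_chain_limit (SET U) (fin_obj H) (fin_map H) L p"
  using limit unfolding final_seq_limit_def .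

lemmas L_in = chain_limit_cone(1)[OF limit']
lemmas p_in = chain_limit_cone(2)[OF limit']
lemmas p_compat = chain_limit_cone(3)[OF limit']
lemmas p_eqI = chain_limit_eqI[OF universe limit']

lemma p_app: "l \<in> L \<Longrightarrow> p n l \<in> fin_obj H n"
  using p_in by blast

text \<open>The final sequence without its first stage is the image of the final sequence under \<open>H\<close>, so
  by continuity its limit is \<open>H L\<close>.\<close>

lemma limit_H:
  "is_chain_limit (SET U) (\<lambda>n. fin_obj H (Suc n)) (\<lambda>n. fin_map H (Suc n))
     (FObj H L) (\<lambda>n. FMap H L (fin_obj H n) (p n))"
proof -
  have "is_op_chain (SET U) (fin_obj H) (fin_map H)"
    unfolding is_op_chain_def using fin_obj_in fin_map_in by simp
  from continuous[unfolded omega_op_continuous_def, THEN spec, THEN spec, THEN spec, THEN spec,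
      THEN mp, OF conjI[OF this limit']]
  show ?thesis by simp
qed

lemmas Hp_eqI = chain_limit_eqI[OF universe limit_H]

definition \<xi> :: "'u \<Rightarrow> 'u" where
  "\<xi> = final_coalg_str H L p"

lemma \<xi>_spec:
  "\<xi> \<in> L \<rightarrow>\<^sub>E FObj H L \<and> (\<forall>n. compose L (FMap H L (fin_obj H n) (p n)) \<xi> = p (Suc n))"
proof -
  have "is_chain_cone (SET U) (\<lambda>n. fin_obj H (Suc n)) (\<lambda>n. fin_map H (Suc n)) L (\<lambda>n. p (Suc n))"
    unfolding chain_cone_iff using L_in p_in p_compat by blast
  from limit_H[unfolded is_chain_limit_def, THEN conjunct2, THEN spec, THEN spec, THEN mp, OF this]
  have "\<exists>!h. h \<in> L \<rightarrow>\<^sub>E FObj H L \<and> (\<forall>n. compose L (FMap H L (fin_obj H n) (p n)) h = p (Suc n))"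
    unfolding SET_simps .
  from theI'[OF this] show ?thesis unfolding \<xi>_def final_coalg_str_def .
qed

lemma \<xi>_in: "\<xi> \<in> L \<rightarrow>\<^sub>E FObj H L"
  using \<xi>_spec by blast

lemma p_\<xi>:
  assumes "l \<in> L"
  shows "FMap H L (fin_obj H n) (p n) (\<xi> l) = p (Suc n) l"
proof -
  have "compose L (FMap H L (fin_obj H n) (p n)) \<xi> = p (Suc n)" using \<xi>_spec by blast
  from fun_cong[OF this, of l] show ?thesis using assms by (simp add: compose_eq)
qed

definition coalg_hom :: "'u set \<Rightarrow> ('u \<Rightarrow> 'u) \<Rightarrow> ('u \<Rightarrow> 'u) \<Rightarrow> bool" where
  "coalg_hom B \<beta> h \<longleftrightarrow> h \<in> B \<rightarrow>\<^sub>E L \<and> (\<forall>b\<in>B. \<xi> (h b) = FMap H B L h (\<beta> b))"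

text \<open>Equality in \<open>H L\<close> is tested by the maps \<open>H p\<^sub>n\<close>.  Under \<open>H p\<^sub>n\<close> the condition on a coalgebra
  morphism becomes the step of the recursion that defines the observations.\<close>

lemma coalg_hom_iff_observe:
  assumes B: "B \<in> U" "\<beta> \<in> B \<rightarrow>\<^sub>E FObj H B" and h: "h \<in> B \<rightarrow>\<^sub>E L"
  shows "coalg_hom B \<beta> h \<longleftrightarrow> (\<forall>n. \<forall>b\<in>B. p n (h b) = observe H B \<beta> n b)"
proof -
  have hb: "h b \<in> L" if "b \<in> B" for b using h that by blast
  have \<beta>b: "\<beta> b \<in> FObj H B" if "b \<in> B" for b using B(2) that by blast
  have step: "FMap H L (fin_obj H n) (p n) (FMap H B L h (\<beta> b)) = observe H B \<beta> (Suc n) b"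
    if "\<And>b. b \<in> B \<Longrightarrow> p n (h b) = observe H B \<beta> n b" and b: "b \<in> B" for n b
    unfolding observe_Suc[OF b]
    by (rule triangle[OF B(1) L_in fin_obj_in h p_in observe_in[OF B] that(1) \<beta>b[OF b]])
  show ?thesis
  proof
    assume hom: "coalg_hom B \<beta> h"
    have "p n (h b) = observe H B \<beta> n b" if "b \<in> B" for n b
      using that
    proof (induction n arbitrary: b)
      case 0
      show ?case
        using p_app[OF hb[OF 0], of 0] PiE_mem[OF observe_in[OF B, of 0] 0]
        unfolding fin_obj.simps(1) by (rule one_unique)
    next
      case (Suc n)
      have "p (Suc n) (h b) = FMap H L (fin_obj H n) (p n) (\<xi> (h b))"
        by (rule p_\<xi>[OF hb[OF Suc.prems], symmetric])
      also have "\<xi> (h b) = FMap H B L h (\<beta> b)"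
        using hom Suc.prems by (simp add: coalg_hom_def)
      finally show ?case using step[OF Suc.IH Suc.prems] by simp
    qed
    then show "\<forall>n. \<forall>b\<in>B. p n (h b) = observe H B \<beta> n b" by blast
  next
    assume obs: "\<forall>n. \<forall>b\<in>B. p n (h b) = observe H B \<beta> n b"
    have "\<xi> (h b) = FMap H B L h (\<beta> b)" if b: "b \<in> B" for b
    proof (rule Hp_eqI)
      show "\<xi> (h b) \<in> FObj H L" using \<xi>_in hb[OF b] by blast
      show "FMap H B L h (\<beta> b) \<in> FObj H L" by (rule app[OF B(1) L_in h \<beta>b[OF b]])
      show "FMap H L (fin_obj H n) (p n) (\<xi> (h b)) = FMap H L (fin_obj H n) (p n) (FMap H B L h (\<beta> b))" for n
        unfolding p_\<xi>[OF hb[OF b]] using step[of n b] obs b by simp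
    qed
    with h show "coalg_hom B \<beta> h" by (simp add: coalg_hom_def)
  qed
qed

lemma coalg_hom_ex1:
  assumes B: "B \<in> U" "\<beta> \<in> B \<rightarrow>\<^sub>E FObj H B"
  shows "\<exists>!h. coalg_hom B \<beta> h"
proof -
  obtain h where h: "h \<in> B \<rightarrow>\<^sub>E L" "\<forall>n. \<forall>b\<in>B. p n (h b) = observe H B \<beta> n b"
    using chain_limit_arrow[OF limit' B(1) observe_in[OF B] observe_compat[OF B]] by blast
  show ?thesis
  proof (rule ex1I)
    show "coalg_hom B \<beta> h" using coalg_hom_iff_observe[OF B h(1)] h(2) by blast
    fix g assume g: "coalg_hom B \<beta> g"
    then have g_in: "g \<in> B \<rightarrow>\<^sub>E L" by (simp add: coalg_hom_def)
    show "g = h"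
    proof (rule PiE_eqI[OF g_in h(1)])
      fix b assume b: "b \<in> B"
      show "g b = h b"
      proof (rule p_eqI)
        show "g b \<in> L" "h b \<in> L" using g_in h(1) b by blast+
        show "p n (g b) = p n (h b)" for n
          using coalg_hom_iff_observe[OF B g_in, THEN iffD1, OF g] h(2) b by simp
      qed
    qed
  qed
qed

lemma final: "is_final_coalgebra (SET U) H L (final_coalg_str H L p)"
  unfolding is_final_coalgebra_def \<xi>_def[symmetric] SET_simps compose_eq_compose_iff
  using L_in \<xi>_in coalg_hom_ex1[unfolded coalg_hom_def] by simp

end

section \<open>Monads and algebra lifts, pointwise\<close>

lemma Alg_obj_iff:
  "(X, x) \<in> Obj (Alg (SET U) M) \<longleftrightarrow> X \<in> U \<and> x \<in> MObj M X \<rightarrow>\<^sub>E X \<and>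
     compose X x (Unit M X) = (\<lambda>a\<in>X. a) \<and>
     (\<forall>a\<in>MObj M (MObj M X). x (Mult M X a) = x (MMap M (MObj M X) X x a))"
  by (auto simp: Alg_def compose_eq_compose_iff)

lemma Alg_hom_iff:
  "f \<in> Hom (Alg (SET U) M) (X, x) (Y, y) \<longleftrightarrow>
     f \<in> X \<rightarrow>\<^sub>E Y \<and> (\<forall>a\<in>MObj M X. f (x a) = y (MMap M X Y f a))"
  by (auto simp: Alg_def compose_eq_compose_iff)

locale lifted_monad = set_functor U H
  for U :: "'u set set" and H :: "('u set, 'u \<Rightarrow> 'u) endofunct" +
  fixes M :: "('u set, 'u \<Rightarrow> 'u) monad"
    and H' :: "('u set \<times> ('u \<Rightarrow> 'u), 'u \<Rightarrow> 'u) endofunct"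
  assumes monad: "is_monad (SET U) M" and lift: "is_algebra_lift (SET U) M H H'"

sublocale lifted_monad \<subseteq> M: set_functor U "Fun M"
  using universe monad by unfold_locales (auto simp: is_monad_def)

context lifted_monad
begin

lemma unit_in: "X \<in> U \<Longrightarrow> Unit M X \<in> X \<rightarrow>\<^sub>E MObj M X"
  using monad unfolding is_monad_def is_nat_trans_def by (simp add: id_funct_def)

lemma mult_in: "X \<in> U \<Longrightarrow> Mult M X \<in> MObj M (MObj M X) \<rightarrow>\<^sub>E MObj M X"
  using monad unfolding is_monad_def is_nat_trans_def by (simp add: comp_funct_def)

lemma unit_natural:
  "X \<in> U \<Longrightarrow> Y \<in> U \<Longrightarrow> f \<in> X \<rightarrow>\<^sub>E Y \<Longrightarrow> a \<in> X \<Longrightarrow> Unit M Y (f a) = MMap M X Y f (Unit M X a)"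
  using monad unfolding is_monad_def is_nat_trans_def
  by (simp add: id_funct_def compose_eq_compose_iff)

lemma mult_natural:
  "X \<in> U \<Longrightarrow> Y \<in> U \<Longrightarrow> f \<in> X \<rightarrow>\<^sub>E Y \<Longrightarrow> a \<in> MObj M (MObj M X) \<Longrightarrow>
    Mult M Y (MMap M (MObj M X) (MObj M Y) (MMap M X Y f) a) = MMap M X Y f (Mult M X a)"
  using monad unfolding is_monad_def is_nat_trans_def
  by (simp add: comp_funct_def compose_eq_compose_iff)

lemma monad_laws:
  assumes "X \<in> U"
  shows "compose (MObj M X) (Mult M X) (Unit M (MObj M X)) = (\<lambda>a\<in>MObj M X. a)"
    and "compose (MObj M X) (Mult M X) (MMap M X (MObj M X) (Unit M X)) = (\<lambda>a\<in>MObj M X. a)"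
    and "compose (MObj M (MObj M (MObj M X))) (Mult M X) (Mult M (MObj M X)) =
      compose (MObj M (MObj M (MObj M X))) (Mult M X) (MMap M (MObj M (MObj M X)) (MObj M X) (Mult M X))"
proof -
  note laws = monad[unfolded is_monad_def SET_simps, THEN conjunct2, THEN conjunct2, THEN conjunct2,
      THEN bspec, OF assms]
  note laws = laws[THEN conjunct1] laws[THEN conjunct2, THEN conjunct1] laws[THEN conjunct2, THEN conjunct2]
  show "compose (MObj M X) (Mult M X) (Unit M (MObj M X)) = (\<lambda>a\<in>MObj M X. a)"
    and "compose (MObj M X) (Mult M X) (MMap M X (MObj M X) (Unit M X)) = (\<lambda>a\<in>MObj M X. a)"
    and "compose (MObj M (MObj M (MObj M X))) (Mult M X) (Mult M (MObj M X)) =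
      compose (MObj M (MObj M (MObj M X))) (Mult M X) (MMap M (MObj M (MObj M X)) (MObj M X) (Mult M X))"
    by (rule laws)+
qed

lemma free_obj:
  assumes "X \<in> U"
  shows "(MObj M X, Mult M X) \<in> Obj (Alg (SET U) M)"
  unfolding Alg_obj_iff
  using M.obj[OF assms] mult_in[OF assms] monad_laws(1,3)[OF assms] unfolding compose_eq_compose_iff
  by (intro conjI)

lemma Alg_unit:
  assumes X: "(X, x) \<in> Obj (Alg (SET U) M)" and a: "a \<in> X"
  shows "x (Unit M X a) = a"
proof -
  have "compose X x (Unit M X) = (\<lambda>a\<in>X. a)" using X by (simp add: Alg_obj_iff)
  from fun_cong[OF this, of a] a show ?thesis by (simp add: compose_eq)
qed

lemma Alg_structure_hom:
  assumes "(X, x) \<in> Obj (Alg (SET U) M)"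
  shows "x \<in> Hom (Alg (SET U) M) (MObj M X, Mult M X) (X, x)"
  using assms by (simp add: Alg_obj_iff Alg_hom_iff)

lemma Alg_hom_compose:
  assumes "X \<in> U" "Y \<in> U" "Z \<in> U" "x \<in> MObj M X \<rightarrow>\<^sub>E X"
    and f: "f \<in> Hom (Alg (SET U) M) (X, x) (Y, y)" and g: "g \<in> Hom (Alg (SET U) M) (Y, y) (Z, z)"
  shows "compose X g f \<in> Hom (Alg (SET U) M) (X, x) (Z, z)"
proof -
  have f': "f \<in> X \<rightarrow>\<^sub>E Y" "\<And>a. a \<in> MObj M X \<Longrightarrow> f (x a) = y (MMap M X Y f a)"
    and g': "g \<in> Y \<rightarrow>\<^sub>E Z" "\<And>a. a \<in> MObj M Y \<Longrightarrow> g (y a) = z (MMap M Y Z g a)"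
    using f g by (auto simp: Alg_hom_iff)
  have "compose X g f (x a) = z (MMap M X Z (compose X g f) a)" if a: "a \<in> MObj M X" for a
  proof -
    have "MMap M Y Z g (MMap M X Y f a) = MMap M X Z (compose X g f) a"
      by (rule M.triangle[OF assms(1-3) f'(1) g'(1) compose_PiE[OF f'(1) g'(1)] _ a])
        (simp add: compose_eq)
    moreover have "x a \<in> X" using assms(4) a by blast
    ultimately show ?thesis
      using f'(2)[OF a] g'(2)[OF M.app[OF assms(1,2) f'(1) a]] by (simp add: compose_eq)
  qed
  then show ?thesis using compose_PiE[OF f'(1) g'(1)] by (simp add: Alg_hom_iff)
qed

lemma Alg_hom_inverse:
  assumes X: "X \<in> U" "Y \<in> U" "y \<in> MObj M Y \<rightarrow>\<^sub>E Y" "x \<in> MObj M X \<rightarrow>\<^sub>E X"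
    and f: "f \<in> Hom (Alg (SET U) M) (X, x) (Y, y)"
    and g: "g \<in> Y \<rightarrow>\<^sub>E X" "\<And>a. a \<in> X \<Longrightarrow> g (f a) = a" "\<And>b. b \<in> Y \<Longrightarrow> f (g b) = b"
  shows "g \<in> Hom (Alg (SET U) M) (Y, y) (X, x)"
proof -
  have f': "f \<in> X \<rightarrow>\<^sub>E Y" "\<And>a. a \<in> MObj M X \<Longrightarrow> f (x a) = y (MMap M X Y f a)"
    using f by (auto simp: Alg_hom_iff)
  have "g (y b) = x (MMap M Y X g b)" if b: "b \<in> MObj M Y" for b
  proof -
    have gb: "MMap M Y X g b \<in> MObj M X" by (rule M.app[OF X(2,1) g(1) b])
    have "y b = y (MMap M X Y f (MMap M Y X g b))"
      by (simp add: M.retract[OF X(2,1) g(1) f'(1) g(3) b])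
    also have "\<dots> = f (x (MMap M Y X g b))" by (rule f'(2)[OF gb, symmetric])
    finally show ?thesis using g(2) PiE_mem[OF X(4) gb] by simp
  qed
  with g(1) show ?thesis by (simp add: Alg_hom_iff)
qed

text \<open>The structure map that the lift puts on \<open>H X\<close> when \<open>x\<close> is a structure on \<open>X\<close>.\<close>

definition lifted_str :: "'u set \<Rightarrow> ('u \<Rightarrow> 'u) \<Rightarrow> 'u \<Rightarrow> 'u" where
  "lifted_str X x = snd (FObj H' (X, x))"

lemma lift_obj_eq:
  assumes "(X, x) \<in> Obj (Alg (SET U) M)"
  shows "FObj H' (X, x) = (FObj H X, lifted_str X x)"
proof -
  have "FObj (forgetful \<circ>\<^sub>F H') (X, x) = FObj (H \<circ>\<^sub>F forgetful) (X, x)"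
    using lift assms unfolding is_algebra_lift_def functor_eq_def by blast
  then have "fst (FObj H' (X, x)) = FObj H X" by (simp add: comp_funct_def forgetful_def)
  then show ?thesis unfolding lifted_str_def by (metis prod.collapse)
qed

lemma lift_obj:
  assumes "(X, x) \<in> Obj (Alg (SET U) M)"
  shows "(FObj H X, lifted_str X x) \<in> Obj (Alg (SET U) M)"
proof -
  have "FObj H' (X, x) \<in> Obj (Alg (SET U) M)"
    using lift assms unfolding is_algebra_lift_def is_functor_def by blast
  then show ?thesis unfolding lift_obj_eq[OF assms] .
qed

lemma lift_hom:
  assumes X: "(X, x) \<in> Obj (Alg (SET U) M)" and Y: "(Y, y) \<in> Obj (Alg (SET U) M)"
    and f: "f \<in> Hom (Alg (SET U) M) (X, x) (Y, y)"
  shows "FMap H X Y f \<in> Hom (Alg (SET U) M) (FObj H X, lifted_str X x) (FObj H Y, lifted_str Y y)"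
proof -
  have "FMap H' (X, x) (Y, y) f \<in> Hom (Alg (SET U) M) (FObj H' (X, x)) (FObj H' (Y, y))"
    using lift assms unfolding is_algebra_lift_def is_functor_def by blast
  moreover have "FMap (forgetful \<circ>\<^sub>F H') (X, x) (Y, y) f = FMap (H \<circ>\<^sub>F forgetful) (X, x) (Y, y) f"
    using lift assms unfolding is_algebra_lift_def functor_eq_def by blast
  then have "FMap H' (X, x) (Y, y) f = FMap H X Y f" by (simp add: comp_funct_def forgetful_def)
  ultimately show ?thesis using lift_obj_eq[OF X] lift_obj_eq[OF Y] by simp
qed

definition lam :: "'u set \<Rightarrow> 'u \<Rightarrow> 'u" where
  "lam X = lift_law (SET U) M H H' X"

lemma lam_eq:
  "lam X = compose (MObj M (FObj H X)) (lifted_str (MObj M X) (Mult M X))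
     (MMap M (FObj H X) (FObj H (MObj M X)) (FMap H X (MObj M X) (Unit M X)))"
  by (simp add: lam_def lift_law_def lifted_str_def free_alg_def)

lemma lam_in:
  assumes X: "X \<in> U"
  shows "lam X \<in> MObj M (FObj H X) \<rightarrow>\<^sub>E FObj H (MObj M X)"
  unfolding lam_eq
  by (rule compose_PiE[OF M.arr[OF obj[OF X] obj[OF M.obj[OF X]] arr[OF X M.obj[OF X] unit_in[OF X]]]])
    (use lift_obj[OF free_obj[OF X]] in \<open>simp add: Alg_obj_iff\<close>)

text \<open>The lifted structure can be recovered from \<open>\<lambda>\<close>: a structure map is a morphism from
  the free algebra, so its image under \<open>H\<close> is a morphism of lifted algebras; precomposition with
  the unit removes the free algebra.\<close>

lemma lifted_str_eq:
  assumes X: "(X, x) \<in> Obj (Alg (SET U) M)" and a: "a \<in> MObj M (FObj H X)"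
  shows "FMap H (MObj M X) X x (lam X a) = lifted_str X x a"
proof -
  have XU: "X \<in> U" and x: "x \<in> MObj M X \<rightarrow>\<^sub>E X" using X by (simp_all add: Alg_obj_iff)
  note MX = M.obj[OF XU]
  note Hu = arr[OF XU MX unit_in[OF XU]] and Hx = arr[OF MX XU x]
  have hom: "FMap H (MObj M X) X x (lifted_str (MObj M X) (Mult M X) b)
      = lifted_str X x (MMap M (FObj H (MObj M X)) (FObj H X) (FMap H (MObj M X) X x) b)"
    if "b \<in> MObj M (FObj H (MObj M X))" for b
    using lift_hom[OF free_obj[OF XU] X Alg_structure_hom[OF X]] that by (simp add: Alg_hom_iff)
  show ?thesis
    unfolding lam_eq compose_eq[OF a] hom[OF M.app[OF obj[OF XU] obj[OF MX] Hu a]]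
    by (subst M.retract[OF obj[OF XU] obj[OF MX] Hu Hx _ a])
      (use retract[OF XU MX unit_in[OF XU] x Alg_unit[OF X]] in auto)
qed

section \<open>The algebra structure on the final coalgebra\<close>

text \<open>The structure of \<open>H\<^sup>n 1\<close> as the \<open>n\<close>-fold lift of the terminal algebra.\<close>

primrec fin_str :: "nat \<Rightarrow> 'u \<Rightarrow> 'u" where
  "fin_str 0 = to_one (MObj M one)"
| "fin_str (Suc n) = lifted_str (fin_obj H n) (fin_str n)"

lemma into_one_hom:
  assumes "X \<in> U" "x \<in> MObj M X \<rightarrow>\<^sub>E X"
  shows "to_one X \<in> Hom (Alg (SET U) M) (X, x) (one, to_one (MObj M one))"
  unfolding Alg_hom_iff
proof (intro conjI ballI to_one_PiE)
  fix a assume a: "a \<in> MObj M X"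
  show "to_one X (x a) = to_one (MObj M one) (MMap M X one (to_one X) a)"
  proof (rule one_unique)
    show "to_one X (x a) \<in> one" by (rule PiE_mem[OF to_one_PiE PiE_mem[OF assms(2) a]])
    show "to_one (MObj M one) (MMap M X one (to_one X) a) \<in> one"
      by (rule PiE_mem[OF to_one_PiE M.app[OF assms(1) universe_one[OF universe] to_one_PiE a]])
  qed
qed

lemma one_alg: "(one, to_one (MObj M one)) \<in> Obj (Alg (SET U) M)"
  unfolding Alg_obj_iff
proof (intro conjI ballI)
  note 1 = universe_one[OF universe]
  note to1 = to_one_PiE[of "MObj M one"]
  show "one \<in> U" by (rule 1)
  show "to_one (MObj M one) \<in> MObj M one \<rightarrow>\<^sub>E one" by (rule to1)
  show "compose one (to_one (MObj M one)) (Unit M one) = (\<lambda>a\<in>one. a)"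
  proof (rule PiE_eqI[OF compose_PiE[OF unit_in[OF 1] to1]])
    show "(\<lambda>a\<in>one. a) \<in> one \<rightarrow>\<^sub>E one" by simp
    show "compose one (to_one (MObj M one)) (Unit M one) a = (\<lambda>a\<in>one. a) a" if "a \<in> one" for a
      by (rule one_unique) (use PiE_mem[OF compose_PiE[OF unit_in[OF 1] to1] that] that in simp_all)
  qed
  fix a assume a: "a \<in> MObj M (MObj M one)"
  show "to_one (MObj M one) (Mult M one a)
      = to_one (MObj M one) (MMap M (MObj M one) one (to_one (MObj M one)) a)"
  proof (rule one_unique)
    show "to_one (MObj M one) (Mult M one a) \<in> one"
      by (rule PiE_mem[OF to1 PiE_mem[OF mult_in[OF 1] a]])
    show "to_one (MObj M one) (MMap M (MObj M one) one (to_one (MObj M one)) a) \<in> one"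
      by (rule PiE_mem[OF to1 M.app[OF M.obj[OF 1] 1 to1 a]])
  qed
qed

lemma fin_alg: "(fin_obj H n, fin_str n) \<in> Obj (Alg (SET U) M)"
proof (induction n)
  case 0
  show ?case using one_alg by simp
next
  case (Suc n)
  from lift_obj[OF this] show ?case by simp
qed

lemma fin_str_in: "fin_str n \<in> MObj M (fin_obj H n) \<rightarrow>\<^sub>E fin_obj H n"
  using fin_alg by (simp add: Alg_obj_iff)

lemma fin_map_hom:
  "fin_map H n \<in> Hom (Alg (SET U) M) (fin_obj H (Suc n), fin_str (Suc n)) (fin_obj H n, fin_str n)"
proof (induction n)
  case 0
  show ?case using into_one_hom[OF fin_obj_in[of "Suc 0"] fin_str_in[of "Suc 0"]] by simp
next
  case (Suc n)
  from lift_hom[OF fin_alg fin_alg this] show ?case by simp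
qed

end

locale lifted_final_sequence = final_sequence U H L p + lifted_monad U H M H'
  for U :: "'u set set" and H L p M H'
begin

text \<open>The final sequence consists of algebra morphisms (\<open>fin_map_hom\<close>), so the structures of the
  \<open>H\<^sup>n 1\<close> form a cone with vertex \<open>M L\<close>.\<close>

lemma alg_str_exists:
  "\<exists>\<gamma>\<in>MObj M L \<rightarrow>\<^sub>E L. \<forall>n. \<forall>a\<in>MObj M L. p n (\<gamma> a) = fin_str n (MMap M L (fin_obj H n) (p n) a)"
proof -
  define q where "q n = compose (MObj M L) (fin_str n) (MMap M L (fin_obj H n) (p n))" for n
  have q: "q n \<in> MObj M L \<rightarrow>\<^sub>E fin_obj H n" for n
    unfolding q_def by (rule compose_PiE[OF M.arr[OF L_in fin_obj_in p_in] fin_str_in])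
  have "fin_map H n (q (Suc n) a) = q n a" if a: "a \<in> MObj M L" for n a
  proof -
    have "fin_map H n (q (Suc n) a)
        = fin_str n (MMap M (fin_obj H (Suc n)) (fin_obj H n) (fin_map H n)
            (MMap M L (fin_obj H (Suc n)) (p (Suc n)) a))"
      unfolding q_def compose_eq[OF a]
      using fin_map_hom[of n] M.app[OF L_in fin_obj_in p_in a, of "Suc n"] unfolding Alg_hom_iff by blast
    also have "\<dots> = q n a"
      unfolding q_def compose_eq[OF a]
      by (subst M.triangle[OF L_in fin_obj_in fin_obj_in p_in fin_map_in p_in p_compat a]) auto
    finally show ?thesis .
  qed
  from chain_limit_arrow[OF limit' M.obj[OF L_in] q this]
  show ?thesis by (auto simp: q_def compose_eq)
qed

definition \<gamma> :: "'u \<Rightarrow> 'u" where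
  "\<gamma> = (SOME \<gamma>. \<gamma> \<in> MObj M L \<rightarrow>\<^sub>E L \<and>
     (\<forall>n. \<forall>a\<in>MObj M L. p n (\<gamma> a) = fin_str n (MMap M L (fin_obj H n) (p n) a)))"

lemma \<gamma>_in: "\<gamma> \<in> MObj M L \<rightarrow>\<^sub>E L"
    and p_\<gamma>: "a \<in> MObj M L \<Longrightarrow> p n (\<gamma> a) = fin_str n (MMap M L (fin_obj H n) (p n) a)"
proof -
  have "\<gamma> \<in> MObj M L \<rightarrow>\<^sub>E L \<and>
     (\<forall>n. \<forall>a\<in>MObj M L. p n (\<gamma> a) = fin_str n (MMap M L (fin_obj H n) (p n) a))"
    unfolding \<gamma>_def by (rule someI_ex[OF alg_str_exists[unfolded Bex_def]])
  then show "\<gamma> \<in> MObj M L \<rightarrow>\<^sub>E L"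
    and "a \<in> MObj M L \<Longrightarrow> p n (\<gamma> a) = fin_str n (MMap M L (fin_obj H n) (p n) a)" by auto
qed

lemma p_hom: "p n \<in> Hom (Alg (SET U) M) (L, \<gamma>) (fin_obj H n, fin_str n)"
  unfolding Alg_hom_iff using p_in p_\<gamma> by blast

lemma L_alg: "(L, \<gamma>) \<in> Obj (Alg (SET U) M)"
  unfolding Alg_obj_iff
proof (intro conjI ballI L_in \<gamma>_in)
  show "compose L \<gamma> (Unit M L) = (\<lambda>a\<in>L. a)"
  proof (rule PiE_eqI[OF compose_PiE[OF unit_in[OF L_in] \<gamma>_in]])
    show "(\<lambda>a\<in>L. a) \<in> L \<rightarrow>\<^sub>E L" by simp
    fix a assume a: "a \<in> L"
    have ua: "Unit M L a \<in> MObj M L" using unit_in[OF L_in] a by blast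
    have "\<gamma> (Unit M L a) = a"
    proof (rule p_eqI)
      show "\<gamma> (Unit M L a) \<in> L" using \<gamma>_in ua by blast
      show "p n (\<gamma> (Unit M L a)) = p n a" for n
        unfolding p_\<gamma>[OF ua] unit_natural[OF L_in fin_obj_in p_in a, symmetric]
        by (rule Alg_unit[OF fin_alg p_app[OF a]])
    qed fact
    with a show "compose L \<gamma> (Unit M L) a = (\<lambda>a\<in>L. a) a" by (simp add: compose_eq)
  qed
  fix a assume a: "a \<in> MObj M (MObj M L)"
  note free_in = M.obj[OF L_in]
  have ma: "Mult M L a \<in> MObj M L" using mult_in[OF L_in] a by blast
  have Ma: "MMap M (MObj M L) L \<gamma> a \<in> MObj M L" by (rule M.app[OF free_in L_in \<gamma>_in a])
  show "\<gamma> (Mult M L a) = \<gamma> (MMap M (MObj M L) L \<gamma> a)"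
  proof (rule p_eqI)
    show "\<gamma> (Mult M L a) \<in> L" "\<gamma> (MMap M (MObj M L) L \<gamma> a) \<in> L" using \<gamma>_in ma Ma by blast+
    fix n
    let ?F = "fin_obj H n"
    have MpA: "MMap M (MObj M L) (MObj M ?F) (MMap M L ?F (p n)) a \<in> MObj M (MObj M ?F)"
      by (rule M.app[OF free_in M.obj[OF fin_obj_in] M.arr[OF L_in fin_obj_in p_in] a])
    have "p n (\<gamma> (Mult M L a)) = fin_str n (Mult M ?F (MMap M (MObj M L) (MObj M ?F) (MMap M L ?F (p n)) a))"
      unfolding p_\<gamma>[OF ma] mult_natural[OF L_in fin_obj_in p_in a] ..
    also have "\<dots> = fin_str n (MMap M (MObj M ?F) ?F (fin_str n)
        (MMap M (MObj M L) (MObj M ?F) (MMap M L ?F (p n)) a))"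
      using fin_alg[of n] MpA by (simp add: Alg_obj_iff)
    also have "\<dots> = fin_str n (MMap M L ?F (p n) (MMap M (MObj M L) L \<gamma> a))"
      by (subst M.square[OF free_in M.obj[OF fin_obj_in] L_in fin_obj_in M.arr[OF L_in fin_obj_in p_in]
            fin_str_in \<gamma>_in p_in p_\<gamma>[symmetric] a]) auto
    also have "\<dots> = p n (\<gamma> (MMap M (MObj M L) L \<gamma> a))" by (rule p_\<gamma>[OF Ma, symmetric])
    finally show "p n (\<gamma> (Mult M L a)) = p n (\<gamma> (MMap M (MObj M L) L \<gamma> a))" .
  qed
qed

text \<open>Both sides agree under every \<open>H p\<^sub>n\<close>, because \<open>p\<^sub>n\<close>, hence \<open>H p\<^sub>n\<close>, is an algebra morphism.\<close>

lemma \<xi>_hom: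
  assumes a: "a \<in> MObj M L"
  shows "\<xi> (\<gamma> a) = lifted_str L \<gamma> (MMap M L (FObj H L) \<xi> a)"
proof (rule Hp_eqI)
  have \<gamma>a: "\<gamma> a \<in> L" using \<gamma>_in a by blast
  have M\<xi>a: "MMap M L (FObj H L) \<xi> a \<in> MObj M (FObj H L)"
    by (rule M.app[OF L_in obj[OF L_in] \<xi>_in a])
  have str: "lifted_str L \<gamma> \<in> MObj M (FObj H L) \<rightarrow>\<^sub>E FObj H L"
    using lift_obj[OF L_alg] by (simp add: Alg_obj_iff)
  show "\<xi> (\<gamma> a) \<in> FObj H L" using \<xi>_in \<gamma>a by blast
  show "lifted_str L \<gamma> (MMap M L (FObj H L) \<xi> a) \<in> FObj H L" using str M\<xi>a by blast
  fix n
  have Hp: "FMap H L (fin_obj H n) (p n) \<in> FObj H L \<rightarrow>\<^sub>E fin_obj H (Suc n)"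
    using arr[OF L_in fin_obj_in p_in] by simp
  have "FMap H L (fin_obj H n) (p n) (lifted_str L \<gamma> (MMap M L (FObj H L) \<xi> a))
      = fin_str (Suc n) (MMap M (FObj H L) (fin_obj H (Suc n)) (FMap H L (fin_obj H n) (p n))
          (MMap M L (FObj H L) \<xi> a))"
    using lift_hom[OF L_alg fin_alg p_hom, of n] M\<xi>a by (simp add: Alg_hom_iff)
  also have "\<dots> = fin_str (Suc n) (MMap M L (fin_obj H (Suc n)) (p (Suc n)) a)"
    by (rule arg_cong[where f = "fin_str (Suc n)"],
      rule M.triangle[OF L_in obj[OF L_in] fin_obj_in \<xi>_in Hp p_in p_\<xi> a])
  also have "\<dots> = p (Suc n) (\<gamma> a)" by (rule p_\<gamma>[OF a, symmetric])
  also have "\<dots> = FMap H L (fin_obj H n) (p n) (\<xi> (\<gamma> a))" by (rule p_\<xi>[OF \<gamma>a, symmetric])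
  finally show "FMap H L (fin_obj H n) (p n) (\<xi> (\<gamma> a))
      = FMap H L (fin_obj H n) (p n) (lifted_str L \<gamma> (MMap M L (FObj H L) \<xi> a))" ..
qed

text \<open>The equation that defines the algebra structure of \<open>L\<close> says that it is a coalgebra morphism
  from \<open>\<lambda>\<^sub>L \<circ> M \<xi>\<close> to \<open>\<xi>\<close>, so finality yields uniqueness.\<close>

lemma final_alg_str_eq: "final_alg_str U M H H' L p = \<gamma>"
proof -
  let ?\<beta> = "compose (MObj M L) (lam L) (MMap M L (FObj H L) \<xi>)"
  note free_in = M.obj[OF L_in]
  have M\<xi>: "MMap M L (FObj H L) \<xi> \<in> MObj M L \<rightarrow>\<^sub>E MObj M (FObj H L)"
    by (rule M.arr[OF L_in obj[OF L_in] \<xi>_in])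
  have \<beta>: "?\<beta> \<in> MObj M L \<rightarrow>\<^sub>E FObj H (MObj M L)"
    by (rule compose_PiE[OF M\<xi> lam_in[OF L_in]])
  have hom: "coalg_hom (MObj M L) ?\<beta> \<gamma>"
    unfolding coalg_hom_def
  proof (intro conjI ballI \<gamma>_in)
    fix a assume a: "a \<in> MObj M L"
    have "MMap M L (FObj H L) \<xi> a \<in> MObj M (FObj H L)" using M\<xi> a by blast
    from lifted_str_eq[OF L_alg this]
    show "\<xi> (\<gamma> a) = FMap H (MObj M L) L \<gamma> (?\<beta> a)"
      unfolding \<xi>_hom[OF a] compose_eq[OF a] ..
  qed
  have "final_alg_str U M H H' L p = (THE g. coalg_hom (MObj M L) ?\<beta> g)"
    unfolding final_alg_str_def Let_def \<xi>_def[symmetric] lam_def[symmetric] coalg_hom_def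
      compose_eq_compose_iff ..
  also have "\<dots> = \<gamma>" by (rule the1_equality[where P = "coalg_hom (MObj M L) ?\<beta>", OF coalg_hom_ex1[OF free_in \<beta>] hom])
  finally show ?thesis .
qed

end

section \<open>The ultrametric of the final sequence\<close>

context final_sequence
begin

lemma p_agree_below:
  assumes "x \<in> L" "y \<in> L" "p n x = p n y" "k \<le> n"
  shows "p k x = p k y"
  using \<open>k \<le> n\<close>
proof (induction rule: inc_induct)
  case base
  show ?case by fact
next
  case (step k)
  then show ?case using p_compat[OF assms(1), of k] p_compat[OF assms(2), of k] by simp
qed

text \<open>The distance looks only for the first index of disagreement; a single comparison suffices
  because agreement at \<open>n\<close> passes down to all smaller indices along the final sequence.\<close>

lemma dist_less_iff:
  assumes x: "x \<in> L" and y: "y \<in> L"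
  shows "final_dist p x y < (1 / 2) ^ n \<longleftrightarrow> p n x = p n y"
proof (cases "x = y")
  case True
  then show ?thesis by (simp add: final_dist_def)
next
  case False
  define m where "m = (LEAST n. p n x \<noteq> p n y)"
  have "\<exists>n. p n x \<noteq> p n y" using False p_eqI[OF x y] by blast
  then have m: "p m x \<noteq> p m y" unfolding m_def by (rule LeastI_ex)
  have least: "p k x = p k y" if "k < m" for k
    using not_less_Least[of k "\<lambda>n. p n x \<noteq> p n y"] that unfolding m_def by blast
  have "p n x = p n y \<longleftrightarrow> n < m"
    using m least p_agree_below[OF x y, of n m] by (metis linorder_not_less)
  moreover have "(1 / 2 :: real) ^ m < (1 / 2) ^ n \<longleftrightarrow> n < m"
    by (rule power_strict_decreasing_iff) auto
  moreover have "final_dist p x y = (1 / 2) ^ m" using False by (simp add: final_dist_def m_def)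
  ultimately show ?thesis by simp
qed

lemma small_power: "0 < (\<epsilon> :: real) \<Longrightarrow> \<exists>n. (1 / 2) ^ n < \<epsilon>"
  by (rule real_arch_pow_inv) auto

lemma dist_nonneg: "0 \<le> final_dist p x y"
  by (simp add: final_dist_def)

lemma dist_le_max:
  assumes x: "x \<in> L" and y: "y \<in> L" and z: "z \<in> L"
  shows "final_dist p x z \<le> max (final_dist p x y) (final_dist p y z)"
proof (cases "x = z")
  case True
  then have "final_dist p x z = 0" by (simp add: final_dist_def)
  then show ?thesis using dist_nonneg[of x y] by (simp add: le_max_iff_disj)
next
  case False
  define m where "m = (LEAST n. p n x \<noteq> p n z)"
  have xz: "final_dist p x z = (1 / 2) ^ m" using False by (simp add: final_dist_def m_def)
  have "p m x \<noteq> p m z" using dist_less_iff[OF x z, of m] xz by simp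
  then have "p m x \<noteq> p m y \<or> p m y \<noteq> p m z" by auto
  then have "\<not> final_dist p x y < (1 / 2) ^ m \<or> \<not> final_dist p y z < (1 / 2) ^ m"
    using dist_less_iff[OF x y] dist_less_iff[OF y z] by simp
  then show ?thesis using xz by auto
qed

lemma dist_commute: "final_dist p x y = final_dist p y x"
proof -
  have "(\<lambda>n. p n x \<noteq> p n y) = (\<lambda>n. p n y \<noteq> p n x)" by auto
  then show ?thesis unfolding final_dist_def by simp
qed

lemma dist_eq_0: "final_dist p x y = 0 \<longleftrightarrow> x = y"
  by (simp add: final_dist_def)

lemma dist_triangle:
  assumes "x \<in> L" "y \<in> L" "z \<in> L"
  shows "final_dist p x z \<le> final_dist p x y + final_dist p y z"
  using dist_le_max[OF assms] dist_nonneg[of x y] dist_nonneg[of y z] by linarith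

sublocale L: Metric_space L "final_dist p"
  by (unfold_locales) (use dist_nonneg dist_commute dist_eq_0 dist_triangle in auto)

lemma complete: "L.mcomplete"
  unfolding L.mcomplete_def
proof (intro allI impI)
  fix \<sigma> assume "L.MCauchy \<sigma>"
  then have \<sigma>: "\<sigma> i \<in> L" and cauchy: "0 < \<epsilon> \<Longrightarrow> \<exists>N. \<forall>i j. N \<le> i \<longrightarrow> N \<le> j \<longrightarrow> final_dist p (\<sigma> i) (\<sigma> j) < \<epsilon>"
    for i \<epsilon> by (auto simp: L.MCauchy_def)
  have "\<exists>N. \<forall>i j. N \<le> i \<longrightarrow> N \<le> j \<longrightarrow> p n (\<sigma> i) = p n (\<sigma> j)" for n
    using cauchy[of "(1 / 2) ^ n"] dist_less_iff[OF \<sigma> \<sigma>] by simp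
  then obtain N where N: "\<And>n i j. N n \<le> i \<Longrightarrow> N n \<le> j \<Longrightarrow> p n (\<sigma> i) = p n (\<sigma> j)"
    by metis
  have "\<exists>l\<in>L. \<forall>n. p n l = p n (\<sigma> (N n))"
  proof (rule chain_limit_thread[OF universe limit'])
    fix n
    show "p n (\<sigma> (N n)) \<in> fin_obj H n" by (rule p_app[OF \<sigma>])
    define k where "k = max (N n) (N (Suc n))"
    have "p (Suc n) (\<sigma> (N (Suc n))) = p (Suc n) (\<sigma> k)" "p n (\<sigma> (N n)) = p n (\<sigma> k)"
      by (rule N; simp add: k_def)+
    then show "fin_map H n (p (Suc n) (\<sigma> (N (Suc n)))) = p n (\<sigma> (N n))"
      using p_compat[OF \<sigma>] by simp
  qed
  then obtain l where l: "l \<in> L" "\<And>n. p n l = p n (\<sigma> (N n))" by blast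
  have "limitin L.mtopology \<sigma> l sequentially"
    unfolding L.limit_metric_sequentially
  proof (intro conjI allI impI l(1))
    fix \<epsilon> :: real assume "0 < \<epsilon>"
    then obtain n where n: "(1 / 2) ^ n < \<epsilon>" using small_power by blast
    have "final_dist p (\<sigma> i) l < \<epsilon>" if "N n \<le> i" for i
    proof -
      have "p n (\<sigma> i) = p n l" unfolding l(2) by (rule N) (use that in auto)
      then have "final_dist p (\<sigma> i) l < (1 / 2) ^ n" using dist_less_iff[OF \<sigma> l(1)] by simp
      with n show ?thesis by linarith
    qed
    then show "\<exists>N. \<forall>n\<ge>N. \<sigma> n \<in> L \<and> final_dist p (\<sigma> n) l < \<epsilon>" using \<sigma> by blast
  qed
  then show "\<exists>x. limitin L.mtopology \<sigma> x sequentially" by blast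
qed

text \<open>The open balls of radius \<open>2\<^sup>-\<^sup>n\<close> are the fibres of \<open>p\<^sub>n\<close>, so a subset is dense as soon as it has
  the same projections as \<open>L\<close>.\<close>

lemma completion_map:
  assumes f: "f \<in> A \<rightarrow> L" and inj: "inj_on f A"
    and dense: "\<And>l n. l \<in> L \<Longrightarrow> \<exists>a\<in>A. p n (f a) = p n l"
  shows "is_completion_map A (\<lambda>x y. final_dist p (f x) (f y)) L (final_dist p) f"
  unfolding is_completion_map_def
proof (intro conjI ballI refl)
  have fL: "f a \<in> L" if "a \<in> A" for a using f that by blast
  show "Metric_space A (\<lambda>x y. final_dist p (f x) (f y))"
  proof
    show "final_dist p (f x) (f y) = 0 \<longleftrightarrow> x = y" if "x \<in> A" "y \<in> A" for x y
      using that inj by (auto simp: dist_eq_0 dest: inj_onD)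
    show "final_dist p (f x) (f z) \<le> final_dist p (f x) (f y) + final_dist p (f y) (f z)"
      if "x \<in> A" "y \<in> A" "z \<in> A" for x y z
      by (rule dist_triangle) (use that fL in auto)
  qed (rule dist_nonneg, rule dist_commute)
  show "Metric_space L (final_dist p)" by (rule L.Metric_space_axioms)
  show "L.mcomplete" by (rule complete)
  show "f \<in> A \<rightarrow> L" by (rule f)
  show "L.mtopology closure_of (f ` A) = L"
  proof (intro equalityI subsetI)
    show "l \<in> L" if "l \<in> L.mtopology closure_of (f ` A)" for l
      using that closure_of_subset_topspace[of L.mtopology] by auto
    show "l \<in> L.mtopology closure_of (f ` A)" if l: "l \<in> L" for l
      unfolding L.metric_closure_of
    proof (intro CollectI conjI allI impI l)
      fix \<epsilon> :: real assume "0 < \<epsilon>"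
      then obtain n where n: "(1 / 2) ^ n < \<epsilon>" using small_power by blast
      obtain a where a: "a \<in> A" "p n (f a) = p n l" using dense[OF l] by blast
      then have "final_dist p l (f a) < (1 / 2) ^ n" using dist_less_iff[OF l fL] by simp
      then have "f a \<in> L.mball l \<epsilon>" using n l fL[OF a(1)] by simp
      with a(1) show "\<exists>y\<in>f ` A. y \<in> L.mball l \<epsilon>" by blast
    qed
  qed
qed

end

section \<open>The free algebra on the initial algebra inside the final coalgebra\<close>

lemma iso_bij:
  assumes "f \<in> X \<rightarrow>\<^sub>E Y" "g \<in> Y \<rightarrow>\<^sub>E X" "compose X g f = (\<lambda>a\<in>X. a)" "compose Y f g = (\<lambda>b\<in>Y. b)"
  shows "bij_betw f X Y"
proof (rule bij_betw_byWitness[where f' = g])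
  show "\<forall>a\<in>X. g (f a) = a"
    using assms(3) compose_eq_iff[of "\<lambda>a\<in>X. a" X X g f] by simp
  show "\<forall>b\<in>Y. f (g b) = b"
    using assms(4) compose_eq_iff[of "\<lambda>b\<in>Y. b" Y Y f g] by simp
  show "f ` X \<subseteq> Y" "g ` Y \<subseteq> X" using assms(1,2) by auto
qed

lemma inverse_arrow:
  assumes f: "f \<in> X \<rightarrow>\<^sub>E Y" "bij_betw f X Y"
  defines "g \<equiv> \<lambda>b\<in>Y. inv_into X f b"
  shows "g \<in> Y \<rightarrow>\<^sub>E X" "\<And>a. a \<in> X \<Longrightarrow> g (f a) = a" "\<And>b. b \<in> Y \<Longrightarrow> f (g b) = b"
    "bij_betw g Y X"
proof -
  note inv = bij_betw_inv_into[OF f(2)]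
  show "g \<in> Y \<rightarrow>\<^sub>E X" using bij_betwE[OF inv] by (auto simp: g_def)
  show "g (f a) = a" if "a \<in> X" for a
    using PiE_mem[OF f(1) that] bij_betw_inv_into_left[OF f(2) that] by (simp add: g_def)
  show "f (g b) = b" if "b \<in> Y" for b
    using bij_betw_inv_into_right[OF f(2) that] that by (simp add: g_def)
  show "bij_betw g Y X" using inv bij_betw_cong[of Y g "inv_into X f" X] by (simp add: g_def)
qed

locale comparison = lifted_final_sequence U H L p M H' + T: set_functor U T
  for U :: "'u set set" and H L p M H' T +
  fixes A :: "'u set" and \<alpha> :: "'u \<Rightarrow> 'u" and \<phi> :: "'u set \<Rightarrow> 'u \<Rightarrow> 'u"
  assumes finitary_T: "finitary U T" and finitary_M: "finitary U (Fun M)"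
    and initial: "is_initial_algebra (SET U) T A \<alpha>"
    and iso: "is_alg_nat_iso (SET U) M H H' T \<phi>"
    and free_empty: "free_empty_eq_one U M"
begin

lemma A_in: "A \<in> U" and \<alpha>_in: "\<alpha> \<in> FObj T A \<rightarrow>\<^sub>E A"
  using initial unfolding initial_algebra_iff by simp_all

lemma \<phi>_in: "X \<in> U \<Longrightarrow> \<phi> X \<in> FObj H (MObj M X) \<rightarrow>\<^sub>E MObj M (FObj T X)"
  using iso unfolding is_alg_nat_iso_def is_nat_iso_def is_nat_trans_def by (simp add: comp_funct_def)

lemma \<phi>_natural:
  "X \<in> U \<Longrightarrow> Y \<in> U \<Longrightarrow> f \<in> X \<rightarrow>\<^sub>E Y \<Longrightarrow> a \<in> FObj H (MObj M X) \<Longrightarrow>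
    \<phi> Y (FMap H (MObj M X) (MObj M Y) (MMap M X Y f) a)
      = MMap M (FObj T X) (FObj T Y) (FMap T X Y f) (\<phi> X a)"
  using iso unfolding is_alg_nat_iso_def is_nat_iso_def is_nat_trans_def
  by (simp add: comp_funct_def compose_eq_compose_iff)

lemma \<phi>_bij:
  assumes X: "X \<in> U"
  shows "bij_betw (\<phi> X) (FObj H (MObj M X)) (MObj M (FObj T X))"
proof -
  have "is_iso (SET U) (FObj H (MObj M X)) (MObj M (FObj T X)) (\<phi> X)"
    using iso X unfolding is_alg_nat_iso_def is_nat_iso_def by (simp add: comp_funct_def)
  then show ?thesis unfolding is_iso_def SET_simps by (elim conjE bexE) (rule iso_bij)
qed

lemma \<phi>_hom:
  assumes X: "X \<in> U"
  shows "\<phi> X \<in> Hom (Alg (SET U) M) (FObj H (MObj M X), lifted_str (MObj M X) (Mult M X))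
    (MObj M (FObj T X), Mult M (FObj T X))"
proof -
  have "\<phi> X \<in> Hom (Alg (SET U) M) (FObj H' (FObj (free_alg M) X)) (FObj (free_alg M) (FObj T X))"
    using iso X unfolding is_alg_nat_iso_def by simp
  then show ?thesis using lift_obj_eq[OF free_obj[OF X]] by (simp add: free_alg_def)
qed

definition \<phi>' :: "'u set \<Rightarrow> 'u \<Rightarrow> 'u" where
  "\<phi>' X = (\<lambda>b\<in>MObj M (FObj T X). inv_into (FObj H (MObj M X)) (\<phi> X) b)"

lemma \<phi>':
  assumes "X \<in> U"
  shows "\<phi>' X \<in> MObj M (FObj T X) \<rightarrow>\<^sub>E FObj H (MObj M X)"
    and "a \<in> FObj H (MObj M X) \<Longrightarrow> \<phi>' X (\<phi> X a) = a"
    and "b \<in> MObj M (FObj T X) \<Longrightarrow> \<phi> X (\<phi>' X b) = b"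
    and "bij_betw (\<phi>' X) (MObj M (FObj T X)) (FObj H (MObj M X))"
  by (rule inverse_arrow[OF \<phi>_in[OF assms] \<phi>_bij[OF assms], folded \<phi>'_def]; assumption)+

lemma \<phi>'_natural:
  assumes X: "X \<in> U" and Y: "Y \<in> U" and f: "f \<in> X \<rightarrow>\<^sub>E Y" and b: "b \<in> MObj M (FObj T X)"
  shows "\<phi>' Y (MMap M (FObj T X) (FObj T Y) (FMap T X Y f) b)
    = FMap H (MObj M X) (MObj M Y) (MMap M X Y f) (\<phi>' X b)"
proof -
  have a: "\<phi>' X b \<in> FObj H (MObj M X)" using \<phi>'(1)[OF X] b by blast
  have "FMap H (MObj M X) (MObj M Y) (MMap M X Y f) (\<phi>' X b) \<in> FObj H (MObj M Y)"
    by (rule app[OF M.obj[OF X] M.obj[OF Y] M.arr[OF X Y f] a])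
  from \<phi>'(2)[OF Y this] show ?thesis
    unfolding \<phi>_natural[OF X Y f a] \<phi>'(3)[OF X b] .
qed

lemma \<phi>'_hom:
  assumes X: "X \<in> U"
  shows "\<phi>' X \<in> Hom (Alg (SET U) M) (MObj M (FObj T X), Mult M (FObj T X))
    (FObj H (MObj M X), lifted_str (MObj M X) (Mult M X))"
proof (rule Alg_hom_inverse[OF _ _ _ _ \<phi>_hom[OF X] \<phi>'(1-3)[OF X]])
  show "FObj H (MObj M X) \<in> U" by (rule obj[OF M.obj[OF X]])
  show "MObj M (FObj T X) \<in> U" by (rule M.obj[OF T.obj[OF X]])
  show "Mult M (FObj T X) \<in> MObj M (MObj M (FObj T X)) \<rightarrow>\<^sub>E MObj M (FObj T X)"
    by (rule mult_in[OF T.obj[OF X]])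
  show "lifted_str (MObj M X) (Mult M X) \<in> MObj M (FObj H (MObj M X)) \<rightarrow>\<^sub>E FObj H (MObj M X)"
    using lift_obj[OF free_obj[OF X]] by (simp add: Alg_obj_iff)
qed

text \<open>The isomorphisms from \<open>M T\<^sup>n 0\<close> to \<open>H\<^sup>n 1\<close>, starting with \<open>M 0 = 1\<close>.\<close>

primrec \<psi> :: "nat \<Rightarrow> 'u \<Rightarrow> 'u" where
  "\<psi> 0 = to_one (MObj M {})"
| "\<psi> (Suc n) = compose (MObj M (init_obj T (Suc n)))
     (FMap H (MObj M (init_obj T n)) (fin_obj H n) (\<psi> n)) (\<phi>' (init_obj T n))"

lemma free_empty_bij: "bij_betw (to_one (MObj M {})) (MObj M {}) one"
proof -
  obtain g where "g \<in> one \<rightarrow>\<^sub>E MObj M {}"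
    "compose (MObj M {}) g (to_one (MObj M {})) = (\<lambda>a\<in>MObj M {}. a)"
    "compose one (to_one (MObj M {})) g = (\<lambda>a\<in>one. a)"
    using free_empty by (auto simp: free_empty_eq_one_def is_iso_def Alg_def free_alg_def)
  then show ?thesis by (rule iso_bij[OF to_one_PiE])
qed

lemma \<psi>_in: "\<psi> n \<in> MObj M (init_obj T n) \<rightarrow>\<^sub>E fin_obj H n"
proof (induction n)
  case 0
  show ?case using to_one_PiE by simp
next
  case (Suc n)
  show ?case
    unfolding \<psi>.simps init_obj.simps fin_obj.simps
    by (rule compose_PiE[OF \<phi>'(1)[OF T.init_obj_in]]) (rule arr[OF M.obj[OF T.init_obj_in] fin_obj_in Suc])
qed

lemma \<psi>_bij: "bij_betw (\<psi> n) (MObj M (init_obj T n)) (fin_obj H n)"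
proof (induction n)
  case 0
  show ?case using free_empty_bij by simp
next
  case (Suc n)
  have "bij_betw (FMap H (MObj M (init_obj T n)) (fin_obj H n) (\<psi> n) \<circ> \<phi>' (init_obj T n))
      (MObj M (FObj T (init_obj T n))) (FObj H (fin_obj H n))"
    by (rule bij_betw_trans[OF \<phi>'(4)[OF T.init_obj_in] bij[OF M.obj[OF T.init_obj_in] fin_obj_in \<psi>_in Suc]])
  then show ?case
    unfolding \<psi>.simps init_obj.simps fin_obj.simps
    by (rule bij_betw_cong[THEN iffD1, rotated]) (simp add: compose_eq)
qed

text \<open>The cocone of the initial chain of \<open>T\<close> under its initial algebra.\<close>

abbreviation c :: "nat \<Rightarrow> 'u \<Rightarrow> 'u" where
  "c \<equiv> fold_map T A \<alpha>"

lemmas c_in = T.fold_map_in[OF A_in \<alpha>_in]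

definition \<alpha>' :: "'u \<Rightarrow> 'u" where
  "\<alpha>' = (\<lambda>a\<in>A. inv_into (FObj T A) \<alpha> a)"

lemmas \<alpha>' = inverse_arrow[OF \<alpha>_in T.Lambek[OF initial], folded \<alpha>'_def]

text \<open>The coalgebra structure on the free algebra; its morphism into \<open>L\<close> is the embedding.\<close>

definition \<delta> :: "'u \<Rightarrow> 'u" where
  "\<delta> = compose (MObj M A) (\<phi>' A) (MMap M A (FObj T A) \<alpha>')"

lemmas TA_in = T.obj[OF A_in]
lemmas MA_in = M.obj[OF A_in]
lemmas HMA_in = obj[OF MA_in]

lemma \<delta>_hom:
  "\<delta> \<in> Hom (Alg (SET U) M) (MObj M A, Mult M A) (FObj H (MObj M A), lifted_str (MObj M A) (Mult M A))"
  unfolding \<delta>_def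
proof (rule Alg_hom_compose[OF MA_in M.obj[OF TA_in] HMA_in mult_in[OF A_in] _ \<phi>'_hom[OF A_in]])
  show "MMap M A (FObj T A) \<alpha>' \<in>
      Hom (Alg (SET U) M) (MObj M A, Mult M A) (MObj M (FObj T A), Mult M (FObj T A))"
    unfolding Alg_hom_iff
    using M.arr[OF A_in TA_in \<alpha>'(1)] mult_natural[OF A_in TA_in \<alpha>'(1)] by simp
qed

lemma \<delta>_in: "\<delta> \<in> MObj M A \<rightarrow>\<^sub>E FObj H (MObj M A)"
  using \<delta>_hom by (simp add: Alg_hom_iff)

text \<open>The projections of the embedding, available before the embedding itself.\<close>

abbreviation q :: "nat \<Rightarrow> 'u \<Rightarrow> 'u" where
  "q \<equiv> observe H (MObj M A) \<delta>"

lemmas q_in = observe_in[OF MA_in \<delta>_in]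

lemma q_hom: "q n \<in> Hom (Alg (SET U) M) (MObj M A, Mult M A) (fin_obj H n, fin_str n)"
proof (induction n)
  case 0
  show ?case using into_one_hom[OF MA_in mult_in[OF A_in]] by simp
next
  case (Suc n)
  show ?case
    unfolding observe.simps fin_obj.simps fin_str.simps
    by (rule Alg_hom_compose[OF MA_in HMA_in obj[OF fin_obj_in] mult_in[OF A_in] \<delta>_hom
          lift_hom[OF free_obj[OF A_in] fin_alg Suc]])
qed

text \<open>On the stages of \<open>M A\<close> the structure \<open>\<delta>\<close> is just \<open>\<phi>\<^sup>-\<^sup>1\<close>: applying \<open>\<alpha>\<^sup>-\<^sup>1\<close> after
  \<open>c\<^sub>n\<^sub>+\<^sub>1 = \<alpha> \<circ> T c\<^sub>n\<close> leaves \<open>T c\<^sub>n\<close>, and \<open>\<phi>\<^sup>-\<^sup>1\<close> is natural.\<close>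

lemma \<delta>_c:
  assumes b: "b \<in> MObj M (FObj T (init_obj T n))"
  shows "\<delta> (MMap M (init_obj T (Suc n)) A (c (Suc n)) b)
    = FMap H (MObj M (init_obj T n)) (MObj M A) (MMap M (init_obj T n) A (c n)) (\<phi>' (init_obj T n) b)"
proof -
  let ?X = "init_obj T n"
  have b': "b \<in> MObj M (init_obj T (Suc n))" using b by simp
  have w: "MMap M (init_obj T (Suc n)) A (c (Suc n)) b \<in> MObj M A"
    by (rule M.app[OF T.init_obj_in A_in c_in b'])
  have Tc: "FMap T ?X A (c n) \<in> init_obj T (Suc n) \<rightarrow>\<^sub>E FObj T A"
    using T.arr[OF T.init_obj_in A_in c_in] by simp
  have "\<alpha>' (c (Suc n) a) = FMap T ?X A (c n) a" if "a \<in> init_obj T (Suc n)" for a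
  proof -
    have "a \<in> FObj T ?X" using that by simp
    from T.fold_map_Suc[OF this] show ?thesis using \<alpha>'(2) PiE_mem[OF Tc that] by simp
  qed
  from M.triangle[OF T.init_obj_in A_in TA_in c_in \<alpha>'(1) Tc this b']
  have "\<delta> (MMap M (init_obj T (Suc n)) A (c (Suc n)) b)
      = \<phi>' A (MMap M (FObj T ?X) (FObj T A) (FMap T ?X A (c n)) b)"
    unfolding \<delta>_def compose_eq[OF w] by simp
  also have "\<dots> = FMap H (MObj M ?X) (MObj M A) (MMap M ?X A (c n)) (\<phi>' ?X b)"
    by (rule \<phi>'_natural[OF T.init_obj_in A_in c_in b])
  finally show ?thesis .
qed

lemma q_c:
  assumes "a \<in> MObj M (init_obj T n)"
  shows "q n (MMap M (init_obj T n) A (c n) a) = \<psi> n a"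
  using assms
proof (induction n arbitrary: a)
  case 0
  have "MMap M (init_obj T 0) A (c 0) a \<in> MObj M A"
    by (rule M.app[OF T.init_obj_in A_in c_in 0])
  from PiE_mem[OF q_in[of 0] this] PiE_mem[OF \<psi>_in 0] show ?case
    unfolding fin_obj.simps(1) by (rule one_unique)
next
  case (Suc n)
  let ?X = "init_obj T n"
  have a: "a \<in> MObj M (FObj T ?X)" using Suc.prems by simp
  have w: "MMap M (init_obj T (Suc n)) A (c (Suc n)) a \<in> MObj M A"
    by (rule M.app[OF T.init_obj_in A_in c_in Suc.prems])
  have d: "\<phi>' ?X a \<in> FObj H (MObj M ?X)" using \<phi>'(1)[OF T.init_obj_in] a by blast
  note MX = M.obj[OF T.init_obj_in]
  have "q (Suc n) (MMap M (init_obj T (Suc n)) A (c (Suc n)) a)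
      = FMap H (MObj M ?X) (fin_obj H n) (\<psi> n) (\<phi>' ?X a)"
    unfolding observe_Suc[OF w] \<delta>_c[OF a]
    by (rule triangle[OF MX MA_in fin_obj_in M.arr[OF T.init_obj_in A_in c_in] q_in \<psi>_in Suc.IH d])
  also have "\<dots> = \<psi> (Suc n) a" using a by (simp add: compose_eq)
  finally show ?case .
qed

lemma c_ascend:
  assumes "a \<in> MObj M (init_obj T n)" "n \<le> k"
  shows "\<exists>b\<in>MObj M (init_obj T k). MMap M (init_obj T k) A (c k) b = MMap M (init_obj T n) A (c n) a"
  using \<open>n \<le> k\<close>
proof (induction rule: dec_induct)
  case base
  show ?case using assms(1) by blast
next
  case (step k)
  then obtain b where b: "b \<in> MObj M (init_obj T k)"
    "MMap M (init_obj T k) A (c k) b = MMap M (init_obj T n) A (c n) a" by blast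
  let ?x = "MMap M (init_obj T k) (init_obj T (Suc k)) (init_map T k)"
  have "c (Suc k) (init_map T k d) = c k d" if "d \<in> init_obj T k" for d
    using T.fold_map_cocone[OF A_in \<alpha>_in] that unfolding is_chain_cocone_def by blast
  from M.triangle[OF T.init_obj_in T.init_obj_in A_in T.init_map_in c_in c_in this b(1)]
  have "MMap M (init_obj T (Suc k)) A (c (Suc k)) (?x b) = MMap M (init_obj T n) A (c n) a"
    unfolding b(2) .
  moreover have "?x b \<in> MObj M (init_obj T (Suc k))"
    by (rule M.app[OF T.init_obj_in T.init_obj_in T.init_map_in b(1)])
  ultimately show ?case by blast
qed

lemma c_surj:
  "w \<in> MObj M A \<Longrightarrow> \<exists>n. \<exists>a\<in>MObj M (init_obj T n). MMap M (init_obj T n) A (c n) a = w"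
  by (rule T.initial_algebra_jointly_surj[OF finitary_T M.is_funct finitary_M initial])

text \<open>Two elements of \<open>M A\<close> come from a common stage \<open>M T\<^sup>n 0\<close>, where \<open>q n\<close> separates them.\<close>

lemma q_separates:
  assumes v: "v \<in> MObj M A" and w: "w \<in> MObj M A" and eq: "\<And>n. q n v = q n w"
  shows "v = w"
proof -
  obtain n a where a: "a \<in> MObj M (init_obj T n)" "MMap M (init_obj T n) A (c n) a = v"
    using c_surj[OF v] by blast
  obtain m b where b: "b \<in> MObj M (init_obj T m)" "MMap M (init_obj T m) A (c m) b = w"
    using c_surj[OF w] by blast
  define k where "k = max n m"
  have k: "n \<le> k" "m \<le> k" by (simp_all add: k_def)
  obtain a' where a': "a' \<in> MObj M (init_obj T k)" "MMap M (init_obj T k) A (c k) a' = v"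
    using c_ascend[OF a(1) k(1)] unfolding a(2) by (elim bexE)
  obtain b' where b': "b' \<in> MObj M (init_obj T k)" "MMap M (init_obj T k) A (c k) b' = w"
    using c_ascend[OF b(1) k(2)] unfolding b(2) by (elim bexE)
  have "\<psi> k a' = \<psi> k b'" using q_c[OF a'(1)] q_c[OF b'(1)] a'(2) b'(2) eq by simp
  then have "a' = b'" by (rule inj_onD[OF bij_betw_imp_inj_on[OF \<psi>_bij] _ a'(1) b'(1)])
  then show ?thesis using a'(2) b'(2) by simp
qed

lemma q_onto:
  assumes "y \<in> fin_obj H n"
  shows "\<exists>w\<in>MObj M A. q n w = y"
proof -
  have "y \<in> \<psi> n ` MObj M (init_obj T n)"
    using assms bij_betw_imp_surj_on[OF \<psi>_bij] by simp
  then obtain a where a: "a \<in> MObj M (init_obj T n)" "\<psi> n a = y" by (elim imageE) simp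
  have "MMap M (init_obj T n) A (c n) a \<in> MObj M A" by (rule M.app[OF T.init_obj_in A_in c_in a(1)])
  then show ?thesis using q_c[OF a(1)] a(2) by (intro bexI) simp
qed

theorem completion:
  "\<exists>d f. f \<in> Hom (Alg (SET U) M) (FObj (free_alg M) A) (L, final_alg_str U M H H' L p) \<and>
    is_completion_map (MObj M A) d L (final_dist p) f"
proof -
  obtain f where hom: "coalg_hom (MObj M A) \<delta> f"
    using coalg_hom_ex1[OF MA_in \<delta>_in] by (rule ex1_implies_ex[THEN exE])
  then have f: "f \<in> MObj M A \<rightarrow>\<^sub>E L" by (simp add: coalg_hom_def)
  have pf: "p n (f a) = q n a" if "a \<in> MObj M A" for n a
    using coalg_hom_iff_observe[OF MA_in \<delta>_in f, THEN iffD1, OF hom] that by simp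
  have "f (Mult M A a) = \<gamma> (MMap M (MObj M A) L f a)" if a: "a \<in> MObj M (MObj M A)" for a
  proof (rule p_eqI)
    have ma: "Mult M A a \<in> MObj M A" using mult_in[OF A_in] a by blast
    have Mfa: "MMap M (MObj M A) L f a \<in> MObj M L" by (rule M.app[OF MA_in L_in f a])
    show "f (Mult M A a) \<in> L" "\<gamma> (MMap M (MObj M A) L f a) \<in> L" using f \<gamma>_in ma Mfa by blast+
    have "MMap M L (fin_obj H n) (p n) (MMap M (MObj M A) L f a) = MMap M (MObj M A) (fin_obj H n) (q n) a"
      for n by (rule M.triangle[OF MA_in L_in fin_obj_in f p_in q_in pf a])
    then show "p n (f (Mult M A a)) = p n (\<gamma> (MMap M (MObj M A) L f a))" for n
      unfolding pf[OF ma] p_\<gamma>[OF Mfa]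
      using q_hom[of n] a by (simp add: Alg_hom_iff)
  qed
  then have "f \<in> Hom (Alg (SET U) M) (FObj (free_alg M) A) (L, final_alg_str U M H H' L p)"
    using f unfolding final_alg_str_eq by (simp add: free_alg_def Alg_hom_iff)
  moreover have "is_completion_map (MObj M A) (\<lambda>x y. final_dist p (f x) (f y)) L (final_dist p) f"
  proof (rule completion_map)
    show "f \<in> MObj M A \<rightarrow> L" using f by (simp add: PiE_def)
    show "inj_on f (MObj M A)"
      by (rule inj_onI, rule q_separates) (simp_all flip: pf)
    show "\<exists>a\<in>MObj M A. p n (f a) = p n l" if "l \<in> L" for l n
      using q_onto[OF p_app[OF that]] pf by auto
  qed
  ultimately show ?thesis by blast
qed

end

theorem corollary14:
  fixes U :: "'u set set"
    and H T :: "('u set, 'u \<Rightarrow> 'u) endofunct"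
    and M :: "('u set, 'u \<Rightarrow> 'u) monad"
    and H' :: "('u set \<times> ('u \<Rightarrow> 'u), 'u \<Rightarrow> 'u) endofunct"
  assumes "set_universe U"
    and "is_functor (SET U) (SET U) H" and "finitary U H"
    and "is_functor (SET U) (SET U) T" and "finitary U T"
    and "is_monad (SET U) M" and "finitary U (Fun M)"
    and "is_algebra_lift (SET U) M H H'"
    and "\<exists>T'. is_kleisli_lift (SET U) M T T'"
    and "\<exists>\<phi>. is_alg_nat_iso (SET U) M H H' T \<phi>"
    and "omega_op_continuous (SET U) H"
    and "free_empty_eq_one U M"
  shows "(\<exists>A \<alpha>. is_initial_algebra (SET U) T A \<alpha>) \<and>
    (\<exists>L p. final_seq_limit U H L p) \<and>
    (\<forall>A \<alpha> L p. is_initial_algebra (SET U) T A \<alpha> \<and> final_seq_limit U H L p \<longrightarrow>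
      is_final_coalgebra (SET U) H L (final_coalg_str H L p) \<and>
      (L, final_alg_str U M H H' L p) \<in> Obj (Alg (SET U) M) \<and>
      (\<exists>d f. f \<in> Hom (Alg (SET U) M) (FObj (free_alg M) A) (L, final_alg_str U M H H' L p) \<and>
        is_completion_map (MObj M A) d L (final_dist p) f))"
proof (intro conjI allI impI; (elim conjE)?)
  interpret T: set_functor U T using assms(1,4) by unfold_locales
  interpret H: set_functor U H using assms(1,2) by unfold_locales
  show "\<exists>A \<alpha>. is_initial_algebra (SET U) T A \<alpha>" by (rule T.initial_algebra_exists[OF assms(5)])
  show "\<exists>L p. final_seq_limit U H L p" by (rule H.final_seq_limit_exists)
  fix A \<alpha> L p
  assume initial: "is_initial_algebra (SET U) T A \<alpha>" and limit: "final_seq_limit U H L p"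
  obtain \<phi> where iso: "is_alg_nat_iso (SET U) M H H' T \<phi>" using assms(10) by blast
  interpret comparison U H L p M H' T A \<alpha> \<phi>
    using assms initial limit iso by unfold_locales
  show "is_final_coalgebra (SET U) H L (final_coalg_str H L p)" by (rule final)
  show "(L, final_alg_str U M H H' L p) \<in> Obj (Alg (SET U) M)"
    unfolding final_alg_str_eq by (rule L_alg)
  show "\<exists>d f. f \<in> Hom (Alg (SET U) M) (FObj (free_alg M) A) (L, final_alg_str U M H H' L p) \<and>
      is_completion_map (MObj M A) d L (final_dist p) f"
    by (rule completion)
qed

end
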